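(* Let $f:\mathbb R\to\mathbb R$ be continuous with $f(u_2)-f(u_1)\le\kappa(u_2-u_1)$ for all $u_1<u_2$. For every $\theta>0$ there exists $C=C(\theta,\kappa)>0$ (depending also only on the dimension $d$) such that for every $T>0$, all $z_1,z_2\in C_b([0,T]\times\mathbb R^d)$, all solutions $u_i$ ($i=1,2$) of $u_i(t,x)=\int_0^t\int_{\mathbb R^d}G(t-s,x-y)f(u_i(s,y))dyds+z_i(t,x)$, and every $x_0\in\mathbb R^d$, $$\sup_{t\in[0,T]}\sup_{x}\frac{|u_1(t,x)-u_2(t,x)|}{1+|x-x_0|^\theta}\le Ce^{CT}\sup_{t\in[0,T]}\sup_x\frac{|z_1(t,x)-z_2(t,x)|}{1+|x-x_0|^\theta}.$$ In particular, for each $z\in C_b([0,T]\times\mathbb R^d)$ the solution of this integral equation is unique; it is denoted $\mathcal M(z)$.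
   Context: $G(t,x)=(2\pi t)^{-d/2}e^{-|x|^2/(2t)}$; $C_b([0,T]\times\mathbb R^d)$ is the space of bounded continuous real functions on $[0,T]\times\mathbb R^d$. *)

theory Defs
  imports "HOL-Analysis.Analysis"
begin

definition heat_kernel :: "real \<Rightarrow> 'a::euclidean_space \<Rightarrow> real" where
  "heat_kernel t x = (2 * pi * t) powr (- (real DIM('a)) / 2) * exp (- (norm x ^ 2) / (2 * t))"

definition Cb :: "real \<Rightarrow> (real \<Rightarrow> 'a::euclidean_space \<Rightarrow> real) set" where
  "Cb T = {z. continuous_on ({0..T} \<times> UNIV) (\<lambda>(t,x). z t x) \<and>
              (\<exists>B. \<forall>t\<in>{0..T}. \<forall>x. \<bar>z t x\<bar> \<le> B)}"

definition is_solution ::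
  "(real \<Rightarrow> real) \<Rightarrow> real \<Rightarrow> (real \<Rightarrow> 'a::euclidean_space \<Rightarrow> real) \<Rightarrow> (real \<Rightarrow> 'a \<Rightarrow> real) \<Rightarrow> bool" where
  "is_solution f T z u \<longleftrightarrow>
     continuous_on ({0..T} \<times> UNIV) (\<lambda>(t,x). u t x) \<and>
     (\<forall>t\<in>{0..T}. \<forall>x.
        set_integrable lborel ({0..t} \<times> UNIV) (\<lambda>(s,y). heat_kernel (t - s) (x - y) * f (u s y)) \<and>
        u t x = (LINT p:{0..t} \<times> UNIV|lborel. (\<lambda>(s,y). heat_kernel (t - s) (x - y) * f (u s y)) p) + z t x)"

definition wsup :: "real \<Rightarrow> real \<Rightarrow> 'a::euclidean_space \<Rightarrow> (real \<Rightarrow> 'a \<Rightarrow> real) \<Rightarrow> real" where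
  "wsup \<theta> T x0 w = (SUP p\<in>{0..T} \<times> UNIV. \<bar>w (fst p) (snd p)\<bar> / (1 + norm (snd p - x0) powr \<theta>))"

end

theory Submission
  imports Defs "HOL-Probability.Distributions" "HOL-Real_Asymp.Real_Asymp"
begin

text \<open>
  Let \<open>V\<^sub>p\<close> be convolution in space-time with \<open>e\<^sup>-\<^sup>p\<^sup>t G(t, x)\<close>, \<open>t > 0\<close>; these operators satisfy the resolvent
  identity \<open>V\<^sub>0 = V\<^sub>p + p V\<^sub>0 V\<^sub>p\<close>. Put \<open>\<zeta> = z\<^sub>1 - z\<^sub>2\<close>, \<open>v = u\<^sub>1 - u\<^sub>2 - \<zeta> = V\<^sub>0 g\<close> with \<open>g = f(u\<^sub>1) - f(u\<^sub>2)\<close>, and let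
  \<open>\<Phi> = 2 M e\<^sup>2\<^sup>\<kappa>\<^sup>t P\<^sub>t w\<close>, where \<open>w\<close> is the polynomial weight, \<open>P\<^sub>t\<close> the heat semigroup and \<open>M\<close> the weighted
  supremum of \<open>\<zeta>\<close>; \<open>\<kappa>\<close> may be assumed positive. Since \<open>w \<le> 2 P\<^sub>t w\<close>, we have \<open>|\<zeta>| \<le> \<Phi>\<close>, so wherever \<open>v \<ge> \<Phi>\<close> also
  \<open>u\<^sub>1 \<ge> u\<^sub>2\<close>, and the one-sided Lipschitz bound gives \<open>g - 2 \<kappa> \<Phi> \<le> \<kappa> h\<close> for \<open>h = (v - \<Phi>)\<^sup>+\<close>. Thus the
  positive part of the charge \<open>r = g - 2 \<kappa> \<Phi> - \<kappa> h\<close> lives on \<open>{v < \<Phi>}\<close>, where \<open>V\<^sub>0 r \<le> 2 M P\<^sub>t w\<close>. By the domination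
  principle this inequality holds everywhere, which says \<open>h \<le> \<kappa> V\<^sub>0 h\<close>. As \<open>V\<^sub>0 h \<le> V\<^sub>0 V\<^sub>0 |g| < \<infinity>\<close>, Gronwall's
  argument yields \<open>h = 0\<close>, i.e. \<open>v \<le> \<Phi>\<close>.

  The solutions are not assumed bounded: the absolute convergence of the integrals is what rules out
  Tychonoff-type non-uniqueness.
\<close>

section \<open>The heat kernel\<close>

lemma nn_integral_lborel_affine:
  fixes f :: "'a::euclidean_space \<Rightarrow> ennreal"
  assumes [measurable]: "f \<in> borel_measurable borel" and c: "c \<noteq> 0"
  shows "(\<integral>\<^sup>+x. f x \<partial>lborel) = ennreal (\<bar>c\<bar> ^ DIM('a)) * (\<integral>\<^sup>+x. f (t + c *\<^sub>R x) \<partial>lborel)"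
  by (subst lborel_affine[OF c, of t])
     (simp add: nn_integral_density nn_integral_distr nn_integral_cmult)

lemma nn_integral_lborel_reflect:
  fixes f :: "'a::euclidean_space \<Rightarrow> ennreal"
  assumes "f \<in> borel_measurable borel"
  shows "(\<integral>\<^sup>+x. f (a - x) \<partial>lborel) = (\<integral>\<^sup>+x. f x \<partial>lborel)"
  using nn_integral_lborel_affine[OF assms, of "-1" a] by simp

lemma nn_integral_lborel_translate:
  fixes f :: "'a::euclidean_space \<Rightarrow> ennreal"
  assumes "f \<in> borel_measurable borel"
  shows "(\<integral>\<^sup>+x. f (x + a) \<partial>lborel) = (\<integral>\<^sup>+x. f x \<partial>lborel)"
  using nn_integral_lborel_affine[OF assms, of 1 a] by (simp add: add.commute)

lemma heat_kernel_nonneg [simp]: "0 \<le> heat_kernel t x"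
  by (simp add: heat_kernel_def)

lemma heat_kernel_0 [simp]: "heat_kernel 0 x = 0"
  by (simp add: heat_kernel_def)

lemma heat_kernel_uminus [simp]: "heat_kernel t (- x) = heat_kernel t x"
  by (simp add: heat_kernel_def)

lemma borel_measurable_heat_kernel [measurable (raw)]:
  assumes [measurable]: "f \<in> borel_measurable M" "g \<in> borel_measurable M"
  shows "(\<lambda>w. heat_kernel (f w) (g w)) \<in> borel_measurable M"
  unfolding heat_kernel_def by measurable

text \<open>The Gaussian factorises over the coordinates, so its total mass reduces to that of the
  one-dimensional normal law of variance \<open>t\<close>.\<close>

lemma heat_kernel_eq_prod_normal_density:
  fixes z :: "'a::euclidean_space"
  assumes "0 < t"
  shows "heat_kernel t z = (\<Prod>b\<in>Basis. normal_density 0 (sqrt t) (z \<bullet> b))"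
proof -
  have "(\<Prod>b\<in>Basis. normal_density 0 (sqrt t) (z \<bullet> b))
      = (1 / sqrt (2 * pi * t)) ^ DIM('a) * exp (\<Sum>b\<in>Basis. - (z \<bullet> b)\<^sup>2 / (2 * t))"
    using assms by (simp add: normal_density_def prod.distrib exp_sum power_one_over prod_dividef)
  also have "(\<Sum>b\<in>Basis. - (z \<bullet> b)\<^sup>2 / (2 * t)) = - (norm z ^ 2) / (2 * t)"
  proof -
    have "norm z ^ 2 = (\<Sum>b\<in>Basis. (z \<bullet> b)\<^sup>2)"
      by (subst power2_norm_eq_inner, subst euclidean_inner) (simp add: power2_eq_square)
    then show ?thesis
      by (simp add: sum_negf sum_divide_distrib[symmetric])
  qed
  also have "(1 / sqrt (2 * pi * t)) ^ DIM('a) = (2 * pi * t) powr (- (real DIM('a)) / 2)"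
  proof -
    have "(1 / sqrt (2 * pi * t)) = (2 * pi * t) powr (- 1 / 2)"
      using assms by (simp add: powr_minus_divide powr_half_sqrt)
    then show ?thesis
      using assms by (simp add: powr_power)
  qed
  finally show ?thesis
    by (simp add: heat_kernel_def)
qed

lemma nn_integral_heat_kernel:
  assumes "0 < t"
  shows "(\<integral>\<^sup>+z. heat_kernel t z \<partial>lborel) = 1"
proof -
  have "(\<integral>\<^sup>+(z::'a). heat_kernel t z \<partial>lborel)
      = (\<integral>\<^sup>+(z::'a). (\<Prod>b\<in>Basis. ennreal (normal_density 0 (sqrt t) (z \<bullet> b))) \<partial>lborel)"
    using assms by (simp add: heat_kernel_eq_prod_normal_density prod_ennreal)
  also have "\<dots> = (\<Prod>b\<in>(Basis :: 'a set). \<integral>\<^sup>+x. normal_density 0 (sqrt t) x \<partial>lborel)"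
    by (rule nn_integral_lborel_prod) auto
  also have "(\<integral>\<^sup>+x. normal_density 0 (sqrt t) x \<partial>lborel) = 1"
    using assms by (subst nn_integral_eq_integral) auto
  finally show ?thesis
    by simp
qed

text \<open>Half of the Gaussian exponent is kept as a heat kernel at time \<open>2 * t\<close>; the
  spare factor \<open>exp (- (norm z ^ 2 / (4 * t)))\<close> is there to absorb growth in
  \<open>z\<close>.\<close>

lemma heat_kernel_double:
  fixes z :: "'a::euclidean_space"
  assumes "0 < t"
  shows "heat_kernel t z = 2 powr (real DIM('a) / 2) * heat_kernel (2 * t) z * exp (- (norm z ^ 2 / (4 * t)))"
proof -
  define d where "d = real DIM('a) / 2"
  have pow: "(2 * pi * t) powr (- d) = 2 powr d * (2 * pi * (2 * t)) powr (- d)"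
  proof -
    have "2 * pi * (2 * t) = 2 * (2 * pi * t)"
      by simp
    then have "(2 * pi * (2 * t)) powr (- d) = 2 powr (- d) * (2 * pi * t) powr (- d)"
      by (simp only: powr_mult)
    moreover have "2 powr d * 2 powr (- d) = (1::real)"
      by (simp flip: powr_add)
    ultimately show ?thesis
      by (simp only: mult.assoc[symmetric] mult_1_left)
  qed
  have "- (norm z ^ 2) / (2 * t) = - (norm z ^ 2) / (2 * (2 * t)) + - (norm z ^ 2 / (4 * t))"
    using assms by (simp add: field_simps)
  then have "exp (- (norm z ^ 2) / (2 * t)) = exp (- (norm z ^ 2) / (2 * (2 * t))) * exp (- (norm z ^ 2 / (4 * t)))"
    by (simp only: exp_add)
  then show ?thesis
    unfolding heat_kernel_def minus_divide_left[of "real DIM('a)", symmetric] d_def[symmetric] pow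
    by (simp only: mult.assoc)
qed

text \<open>\<open>X\<close>, \<open>Y\<close>, \<open>Z\<close> stand for
  \<open>z \<bullet> z\<close>, \<open>\<xi> \<bullet> \<xi>\<close> and
  \<open>z \<bullet> \<xi>\<close>; the last numerator is then the squared norm of
  \<open>\<xi> - (b / (a + b)) *\<^sub>R z\<close>.\<close>

lemma completing_square:
  fixes a b X Y Z :: real
  assumes "0 < a" "0 < b"
  shows "(X - 2 * Z + Y) / a + Y / b
    = X / (a + b) + (Y - 2 * (b / (a + b)) * Z + (b / (a + b)) ^ 2 * X) / (a * b / (a + b))"
proof -
  define s where "s = a + b"
  have s: "s \<noteq> 0" "b \<noteq> 0" "a \<noteq> 0" using assms by (auto simp: s_def)
  have "(Y - 2 * (b / s) * Z + (b / s) ^ 2 * X) / (a * b / s) = s * Y / (a*b) - 2 * Z / a + b * X / (a * s)"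
    using s by (simp add: field_simps power2_eq_square)
  moreover have "s * Y / (a*b) = Y / a + Y / b"
    using s by (simp add: field_simps s_def)
  moreover have "X / s + b * X / (a * s) = X / a"
    using s by (simp add: field_simps) (simp add: s_def algebra_simps)
  ultimately show ?thesis unfolding s_def[symmetric]
    by (simp add: diff_divide_distrib add_divide_distrib)
qed

text \<open>The product of two heat kernels is a heat kernel times the law of a Brownian bridge.\<close>

lemma heat_kernel_mult:
  fixes z \<xi> :: "'a::euclidean_space"
  assumes "0 < a" "0 < b"
  shows "heat_kernel a (z - \<xi>) * heat_kernel b \<xi>
    = heat_kernel (a + b) z * heat_kernel (a * b / (a + b)) (\<xi> - (b / (a + b)) *\<^sub>R z)"
proof -
  have "(2 * pi * a) * (2 * pi * b) = (2 * pi * (a + b)) * (2 * pi * (a * b / (a + b)))"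
    using assms by (simp add: field_simps)
  then have pw: "(2 * pi * a) powr r * (2 * pi * b) powr r
      = (2 * pi * (a + b)) powr r * (2 * pi * (a * b / (a + b))) powr r" for r
    using assms by (simp only: powr_mult[symmetric])
  define c where "c = b / (a + b)"
  have "- (norm (z - \<xi>) ^ 2) / (2 * a) + - (norm \<xi> ^ 2) / (2 * b)
      = - (((z \<bullet> z - 2 * (z \<bullet> \<xi>) + \<xi> \<bullet> \<xi>) / a + (\<xi> \<bullet> \<xi>) / b) / 2)"
    unfolding power2_norm_eq_inner
    by (simp add: inner_diff_left inner_diff_right inner_commute[of \<xi> z] add_divide_distrib diff_divide_distrib)
  also have "\<dots> = - (norm z ^ 2) / (2 * (a + b))
        + - (norm (\<xi> - c *\<^sub>R z) ^ 2) / (2 * (a * b / (a + b)))"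
  proof -
    have n: "norm (\<xi> - c *\<^sub>R z) ^ 2 = \<xi> \<bullet> \<xi> - 2 * c * (z \<bullet> \<xi>) + c ^ 2 * (z \<bullet> z)"
      unfolding power2_norm_eq_inner
      by (simp add: inner_diff_left inner_diff_right inner_commute[of \<xi> z] power2_eq_square algebra_simps)
    have e: "- ((x / s + y / d) / 2) = - x / (2 * s) + - y / (2 * d)" for x y s d :: real
      by (simp add: add_divide_distrib)
    show ?thesis
      by (simp only: completing_square[OF assms] c_def[symmetric] e n power2_norm_eq_inner[of z])
  qed
  finally have "- (norm (z - \<xi>) ^ 2) / (2 * a) + - (norm \<xi> ^ 2) / (2 * b)
      = - (norm z ^ 2) / (2 * (a + b))
        + - (norm (\<xi> - (b / (a + b)) *\<^sub>R z) ^ 2) / (2 * (a * b / (a + b)))"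
    unfolding c_def .
  then have ex: "exp (- (norm (z - \<xi>) ^ 2) / (2 * a)) * exp (- (norm \<xi> ^ 2) / (2 * b))
      = exp (- (norm z ^ 2) / (2 * (a + b)))
        * exp (- (norm (\<xi> - (b / (a + b)) *\<^sub>R z) ^ 2) / (2 * (a * b / (a + b))))"
    by (metis exp_add)
  have interchange: "(p * e) * (q * f) = (p * q) * (e * f)" for p e q f :: real
    by (simp add: ac_simps)
  have "p * q = p' * q' \<Longrightarrow> e * f = e' * f' \<Longrightarrow> (p * e) * (q * f) = (p' * e') * (q' * f')"
    for p q e f p' q' e' f' :: real
    by (subst interchange, subst interchange[of p']) simp
  from this[OF pw ex] show ?thesis
    unfolding heat_kernel_def .
qed

text \<open>By \<open>heat_kernel_mult\<close> the integrand is a constant times a translated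
  Gaussian density in \<open>\<xi>\<close>, which has mass one.\<close>

lemma Chapman_Kolmogorov:
  fixes z :: "'a::euclidean_space"
  assumes "0 < a" "0 < b"
  shows "(\<integral>\<^sup>+\<xi>. ennreal (heat_kernel a (z - \<xi>)) * ennreal (heat_kernel b \<xi>) \<partial>lborel)
    = heat_kernel (a + b) z"
proof -
  have "(\<integral>\<^sup>+\<xi>. ennreal (heat_kernel a (z - \<xi>)) * ennreal (heat_kernel b \<xi>) \<partial>lborel)
    = (\<integral>\<^sup>+\<xi>. ennreal (heat_kernel (a + b) z)
          * ennreal (heat_kernel (a * b / (a + b)) (\<xi> + - ((b / (a + b)) *\<^sub>R z))) \<partial>lborel)"
    using heat_kernel_mult[OF assms, of z] by (simp flip: ennreal_mult')
  also have "\<dots> = ennreal (heat_kernel (a + b) z)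
      * (\<integral>\<^sup>+\<xi>. ennreal (heat_kernel (a * b / (a + b)) (\<xi> + - ((b / (a + b)) *\<^sub>R z))) \<partial>lborel)"
    by (rule nn_integral_cmult) measurable
  also have "(\<integral>\<^sup>+\<xi>. ennreal (heat_kernel (a * b / (a + b)) (\<xi> + - ((b / (a + b)) *\<^sub>R z))) \<partial>lborel) = 1"
    using assms
    by (subst nn_integral_lborel_translate[where f = "\<lambda>\<xi>. ennreal (heat_kernel _ \<xi>)"])
       (auto simp: nn_integral_heat_kernel)
  finally show ?thesis
    by simp
qed

section \<open>Potentials of the heat semigroup\<close>

lemma nn_integral_lborel_pair:
  fixes f :: "'a::euclidean_space \<times> 'b::euclidean_space \<Rightarrow> ennreal"
  assumes "f \<in> borel_measurable borel"
  shows "(\<integral>\<^sup>+Q. f Q \<partial>lborel) = (\<integral>\<^sup>+s. \<integral>\<^sup>+y. f (s, y) \<partial>lborel \<partial>lborel)"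
proof -
  have "f \<in> borel_measurable (lborel \<Otimes>\<^sub>M lborel)"
    using assms by (simp add: lborel_prod)
  from lborel.nn_integral_fst[OF this] show ?thesis
    by (simp add: lborel_prod)
qed

lemma borel_measurable_fst_comp [measurable (raw)]:
  fixes f :: "'c \<Rightarrow> 'a::topological_space \<times> 'b::topological_space"
  assumes "f \<in> borel_measurable M"
  shows "(\<lambda>w. fst (f w)) \<in> borel_measurable M"
  using assms by (rule borel_measurable_continuous_on[rotated]) (intro continuous_intros)

lemma borel_measurable_snd_comp [measurable (raw)]:
  fixes f :: "'c \<Rightarrow> 'a::topological_space \<times> 'b::topological_space"
  assumes "f \<in> borel_measurable M"
  shows "(\<lambda>w. snd (f w)) \<in> borel_measurable M"
  using assms by (rule borel_measurable_continuous_on[rotated]) (intro continuous_intros)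

text \<open>The fundamental solution of the operator d/dt - Delta/2 + p, extended by zero to
  nonpositive times. The extension makes every space-time integral a convolution over the whole
  space, so that translation invariance applies.\<close>

definition causal_kernel :: "real \<Rightarrow> real \<times> 'a::euclidean_space \<Rightarrow> real" where
  "causal_kernel p Q = (if 0 < fst Q then exp (- p * fst Q) * heat_kernel (fst Q) (snd Q) else 0)"

text \<open>Values in \<open>ennreal\<close> let Tonelli's theorem and the resolvent identity hold
  without integrability conditions; finiteness enters separately, where terms are cancelled or
  limits are taken.\<close>

definition potential ::
  "real \<Rightarrow> (real \<times> 'a::euclidean_space \<Rightarrow> ennreal) \<Rightarrow> real \<times> 'a \<Rightarrow> ennreal" where
  "potential p h P = (\<integral>\<^sup>+Q. ennreal (causal_kernel p (P - Q)) * h Q \<partial>lborel)"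

lemma causal_kernel_nonneg [simp]: "0 \<le> causal_kernel p Q"
  by (simp add: causal_kernel_def)

lemma causal_kernel_eq_0: "fst Q \<le> 0 \<Longrightarrow> causal_kernel p Q = 0"
  by (simp add: causal_kernel_def)

lemma causal_kernel_eq: "causal_kernel p Q = exp (- p * fst Q) * causal_kernel 0 Q"
  by (simp add: causal_kernel_def)

lemma borel_measurable_causal_kernel [measurable (raw)]:
  assumes [measurable]: "f \<in> borel_measurable M"
  shows "(\<lambda>w. causal_kernel p (f w)) \<in> borel_measurable M"
  unfolding causal_kernel_def by measurable

lemma borel_measurable_potential [measurable]:
  fixes h :: "real \<times> 'a::euclidean_space \<Rightarrow> ennreal"
  assumes [measurable]: "h \<in> borel_measurable borel"
  shows "potential p h \<in> borel_measurable borel"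
  unfolding potential_def[abs_def] by measurable

text \<open>Causality: the kernel vanishes unless \<open>Q\<close> is strictly earlier than
  \<open>P\<close>, so an inequality known only up to time \<open>T\<close> can still be
  integrated.\<close>

lemma potential_mono:
  assumes "\<And>Q. fst Q < fst P \<Longrightarrow> h Q \<le> h' Q"
  shows "potential p h P \<le> potential p h' P"
  unfolding potential_def
proof (rule nn_integral_mono)
  fix Q
  show "ennreal (causal_kernel p (P - Q)) * h Q \<le> ennreal (causal_kernel p (P - Q)) * h' Q"
    using assms[of Q] by (cases "fst Q < fst P") (auto simp: causal_kernel_eq_0 intro: mult_left_mono)
qed

lemma potential_cong:
  assumes "\<And>Q. fst Q < fst P \<Longrightarrow> h Q = h' Q"
  shows "potential p h P = potential p h' P"
  using assms by (intro antisym potential_mono) auto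

lemma potential_add:
  assumes "h \<in> borel_measurable borel" "h' \<in> borel_measurable borel"
  shows "potential p (\<lambda>Q. h Q + h' Q) P = potential p h P + potential p h' P"
  using assms unfolding potential_def by (simp add: distrib_left nn_integral_add)

lemma potential_cmult:
  assumes "h \<in> borel_measurable borel"
  shows "potential p (\<lambda>Q. c * h Q) P = c * potential p h P"
  using assms unfolding potential_def by (simp add: mult.left_commute nn_integral_cmult)

section \<open>Composition of potentials and the resolvent identity\<close>

text \<open>Tonelli, then a translation of the inner integral by \<open>R\<close>: only the
  convolution of the two kernels remains to be computed.\<close>

lemma potential_potential:
  fixes h :: "real \<times> 'a::euclidean_space \<Rightarrow> ennreal"
  assumes [measurable]: "h \<in> borel_measurable borel"
  shows "potential p (potential q h) P
    = (\<integral>\<^sup>+R. (\<integral>\<^sup>+Q. ennreal (causal_kernel p (P - R - Q)) * ennreal (causal_kernel q Q) \<partial>lborel) * h R \<partial>lborel)"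
proof -
  have "potential p (potential q h) P
    = (\<integral>\<^sup>+Q. \<integral>\<^sup>+R. ennreal (causal_kernel p (P - Q)) * (ennreal (causal_kernel q (Q - R)) * h R) \<partial>lborel \<partial>lborel)"
    unfolding potential_def by (simp add: nn_integral_cmult)
  also have "\<dots> = (\<integral>\<^sup>+R. \<integral>\<^sup>+Q. ennreal (causal_kernel p (P - Q)) * (ennreal (causal_kernel q (Q - R)) * h R) \<partial>lborel \<partial>lborel)"
    by (rule lborel_pair.Fubini') measurable
  also have "\<dots> = (\<integral>\<^sup>+R. (\<integral>\<^sup>+Q. ennreal (causal_kernel p (P - Q)) * ennreal (causal_kernel q (Q - R)) \<partial>lborel) * h R \<partial>lborel)"
    by (simp add: mult.assoc[symmetric] nn_integral_multc)
  also have "\<dots> = (\<integral>\<^sup>+R. (\<integral>\<^sup>+Q. ennreal (causal_kernel p (P - R - Q)) * ennreal (causal_kernel q Q) \<partial>lborel) * h R \<partial>lborel)"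
  proof (rule nn_integral_cong, rule arg_cong2[where f = "(*)", OF _ refl])
    fix R :: "real \<times> 'a"
    show "(\<integral>\<^sup>+Q. ennreal (causal_kernel p (P - Q)) * ennreal (causal_kernel q (Q - R)) \<partial>lborel)
      = (\<integral>\<^sup>+Q. ennreal (causal_kernel p (P - R - Q)) * ennreal (causal_kernel q Q) \<partial>lborel)"
      by (subst nn_integral_lborel_translate[where a = R, symmetric]) (auto simp: algebra_simps)
  qed
  finally show ?thesis .
qed

text \<open>Substituting \<open>X - Q\<close> for \<open>Q\<close> exchanges the two factors of the
  kernel convolution.\<close>

lemma potential_commute:
  fixes h :: "real \<times> 'a::euclidean_space \<Rightarrow> ennreal"
  assumes "h \<in> borel_measurable borel"
  shows "potential p (potential q h) P = potential q (potential p h) P"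
proof -
  have "(\<integral>\<^sup>+Q. ennreal (causal_kernel p (X - Q)) * ennreal (causal_kernel q Q) \<partial>lborel)
      = (\<integral>\<^sup>+Q. ennreal (causal_kernel q (X - Q)) * ennreal (causal_kernel p Q) \<partial>lborel)" for X :: "real \<times> 'a"
    by (subst nn_integral_lborel_reflect[where a = X, symmetric]) (auto simp: mult.commute)
  then show ?thesis
    using assms by (simp add: potential_potential)
qed

text \<open>At each time strictly between 0 and \<open>fst P\<close>, Chapman-Kolmogorov carries out
  the space integral and returns the same kernel at \<open>P\<close>; only a time integral is
  left.\<close>

lemma causal_kernel_convolution:
  fixes P :: "real \<times> 'a::euclidean_space"
  shows "(\<integral>\<^sup>+Q. ennreal (causal_kernel 0 (P - Q)) * ennreal (causal_kernel p Q) \<partial>lborel)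
    = ennreal (causal_kernel 0 P) * (\<integral>\<^sup>+\<sigma>. ennreal (exp (- p * \<sigma>)) * indicator {0<..<fst P} \<sigma> \<partial>lborel)"
proof -
  obtain \<tau> z where P: "P = (\<tau>, z)"
    by (cases P)
  have "(\<integral>\<^sup>+Q. ennreal (causal_kernel 0 (P - Q)) * ennreal (causal_kernel p Q) \<partial>lborel)
      = (\<integral>\<^sup>+\<sigma>. \<integral>\<^sup>+\<xi>. ennreal (causal_kernel 0 (P - (\<sigma>, \<xi>))) * ennreal (causal_kernel p (\<sigma>, \<xi>)) \<partial>lborel \<partial>lborel)"
    by (rule nn_integral_lborel_pair) measurable
  also have "\<dots> = (\<integral>\<^sup>+\<sigma>. ennreal (causal_kernel 0 P) * (ennreal (exp (- p * \<sigma>)) * indicator {0<..<fst P} \<sigma>) \<partial>lborel)"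
  proof (rule nn_integral_cong)
    fix \<sigma> :: real
    show "(\<integral>\<^sup>+\<xi>. ennreal (causal_kernel 0 (P - (\<sigma>, \<xi>))) * ennreal (causal_kernel p (\<sigma>, \<xi>)) \<partial>lborel)
      = ennreal (causal_kernel 0 P) * (ennreal (exp (- p * \<sigma>)) * indicator {0<..<fst P} \<sigma>)"
    proof (cases "0 < \<sigma> \<and> \<sigma> < \<tau>")
      case True
      have "(\<integral>\<^sup>+\<xi>. ennreal (causal_kernel 0 (P - (\<sigma>, \<xi>))) * ennreal (causal_kernel p (\<sigma>, \<xi>)) \<partial>lborel)
          = (\<integral>\<^sup>+\<xi>. ennreal (exp (- p * \<sigma>)) * (ennreal (heat_kernel (\<tau> - \<sigma>) (z - \<xi>)) * ennreal (heat_kernel \<sigma> \<xi>)) \<partial>lborel)"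
        using True by (simp add: P causal_kernel_def ennreal_mult' mult.left_commute)
      also have "\<dots> = ennreal (exp (- p * \<sigma>)) * ennreal (heat_kernel \<tau> z)"
        using True Chapman_Kolmogorov[of "\<tau> - \<sigma>" \<sigma> z] by (simp add: nn_integral_cmult)
      finally show ?thesis
        using True by (simp add: P causal_kernel_def mult.commute)
    next
      case False
      then have "ennreal (causal_kernel 0 (P - (\<sigma>, \<xi>))) * ennreal (causal_kernel p (\<sigma>, \<xi>)) = 0" for \<xi>
        by (auto simp: P causal_kernel_def)
      then show ?thesis
        using False by (simp only: P) auto
    qed
  qed
  also have "\<dots> = ennreal (causal_kernel 0 P) * (\<integral>\<^sup>+\<sigma>. ennreal (exp (- p * \<sigma>)) * indicator {0<..<fst P} \<sigma> \<partial>lborel)"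
    by (rule nn_integral_cmult) measurable
  finally show ?thesis .
qed

text \<open>Multiplying by \<open>p\<close> avoids a division, so \<open>p = 0\<close> is included;
  for \<open>p \<le> 0\<close> both sides are truncated to zero by \<open>ennreal\<close>.\<close>

lemma nn_integral_exp_Ioo:
  fixes p \<tau> :: real
  assumes "0 \<le> \<tau>"
  shows "ennreal p * (\<integral>\<^sup>+\<sigma>. ennreal (exp (- p * \<sigma>)) * indicator {0<..<\<tau>} \<sigma> \<partial>lborel) = ennreal (1 - exp (- p * \<tau>))"
proof (cases "0 < p")
  case True
  have "(\<integral>\<^sup>+\<sigma>. ennreal (exp (- p * \<sigma>)) * indicator {0<..<\<tau>} \<sigma> \<partial>lborel)
      = (\<integral>\<^sup>+\<sigma>. ennreal (exp (- p * \<sigma>)) * indicator {0..\<tau>} \<sigma> \<partial>lborel)"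
    using AE_lborel_singleton[of 0] AE_lborel_singleton[of \<tau>]
    by (intro nn_integral_cong_AE) (auto split: split_indicator elim!: eventually_elim2)
  also have "\<dots> = ennreal (- exp (- p * \<tau>) / p - (- exp (- p * 0) / p))"
    using True assms
    by (intro nn_integral_FTC_Icc) (auto intro!: derivative_eq_intros simp: field_simps)
  finally show ?thesis
    using True assms by (simp add: ennreal_mult'[symmetric] field_simps)
next
  case False
  then have "1 - exp (- p * \<tau>) \<le> 0"
    using assms by (simp add: mult_nonpos_nonneg)
  with False show ?thesis
    by (simp add: ennreal_neg)
qed

text \<open>For elapsed time \<open>\<tau>\<close> this is the splitting
  \<open>1 = exp (- p * \<tau>) + (1 - exp (- p * \<tau>))\<close>, whose second part is the
  convolution term.\<close>

lemma causal_kernel_resolvent: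
  fixes P :: "real \<times> 'a::euclidean_space"
  assumes "0 \<le> p"
  shows "ennreal (causal_kernel 0 P) = ennreal (causal_kernel p P)
    + ennreal p * (\<integral>\<^sup>+Q. ennreal (causal_kernel 0 (P - Q)) * ennreal (causal_kernel p Q) \<partial>lborel)"
proof (cases "0 < fst P")
  case True
  have "ennreal p * (\<integral>\<^sup>+Q. ennreal (causal_kernel 0 (P - Q)) * ennreal (causal_kernel p Q) \<partial>lborel)
    = ennreal (causal_kernel 0 P) * ennreal (1 - exp (- p * fst P))"
    unfolding causal_kernel_convolution using True nn_integral_exp_Ioo[of "fst P" p]
    by (subst mult.left_commute) simp
  moreover have "exp (- p * fst P) \<le> 1"
    using True assms by simp
  moreover have "ennreal (causal_kernel p P) = ennreal (causal_kernel 0 P) * ennreal (exp (- p * fst P))"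
    by (subst causal_kernel_eq) (simp add: ennreal_mult' mult.commute)
  ultimately show ?thesis
    by (simp add: distrib_left[symmetric] ennreal_plus[symmetric] del: ennreal_plus)
next
  case False
  then show ?thesis
    unfolding causal_kernel_convolution by (simp add: causal_kernel_eq_0)
qed

lemma potential_resolvent:
  fixes h :: "real \<times> 'a::euclidean_space \<Rightarrow> ennreal"
  assumes [measurable]: "h \<in> borel_measurable borel" and "0 \<le> p"
  shows "potential 0 h P = potential p h P + ennreal p * potential 0 (potential p h) P"
proof -
  have "potential 0 h P = (\<integral>\<^sup>+R. ennreal (causal_kernel p (P - R)) * h R
    + ennreal p * ((\<integral>\<^sup>+Q. ennreal (causal_kernel 0 (P - R - Q)) * ennreal (causal_kernel p Q) \<partial>lborel) * h R) \<partial>lborel)"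
    unfolding potential_def
    by (subst causal_kernel_resolvent[OF assms(2)]) (simp add: distrib_right mult.assoc)
  also have "\<dots> = potential p h P + ennreal p * potential 0 (potential p h) P"
    by (subst nn_integral_add) (simp_all add: nn_integral_cmult potential_potential, simp add: potential_def)
  finally show ?thesis .
qed

section \<open>Iterated potentials, absorption and Gronwall's argument\<close>

text \<open>The kernel convolved with itself is the elapsed time times the kernel, and the elapsed
  time is at most \<open>fst P\<close> since \<open>h\<close> starts at time 0. Finiteness of a
  potential thus passes to the iterated potential.\<close>

lemma potential_potential_le:
  fixes h :: "real \<times> 'a::euclidean_space \<Rightarrow> ennreal"
  assumes [measurable]: "h \<in> borel_measurable borel" and h: "\<And>Q. fst Q < 0 \<Longrightarrow> h Q = 0"
  shows "potential 0 (potential 0 h) P \<le> ennreal (fst P) * potential 0 h P"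
proof -
  have "potential 0 (potential 0 h) P \<le> (\<integral>\<^sup>+R. ennreal (fst P) * (ennreal (causal_kernel 0 (P - R)) * h R) \<partial>lborel)"
    unfolding potential_potential[OF assms(1)]
  proof (rule nn_integral_mono)
    fix R :: "real \<times> 'a"
    show "(\<integral>\<^sup>+Q. ennreal (causal_kernel 0 (P - R - Q)) * ennreal (causal_kernel 0 Q) \<partial>lborel) * h R
      \<le> ennreal (fst P) * (ennreal (causal_kernel 0 (P - R)) * h R)"
    proof (cases "0 \<le> fst R \<and> fst R < fst P")
      case True
      then have "(\<integral>\<^sup>+\<sigma>. indicator {0<..<fst P - fst R} \<sigma> \<partial>lborel) \<le> ennreal (fst P)"
        by (simp add: ennreal_leI)
      then have "ennreal (causal_kernel 0 (P - R)) * (\<integral>\<^sup>+\<sigma>. indicator {0<..<fst P - fst R} \<sigma> \<partial>lborel) * h R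
        \<le> ennreal (causal_kernel 0 (P - R)) * ennreal (fst P) * h R"
        by (intro mult_right_mono mult_left_mono) auto
      then show ?thesis
        unfolding causal_kernel_convolution by (simp add: ac_simps)
    next
      case False
      then show ?thesis
        using h[of R] unfolding causal_kernel_convolution by (auto simp: causal_kernel_eq_0)
    qed
  qed
  also have "\<dots> = ennreal (fst P) * potential 0 h P"
    unfolding potential_def by (rule nn_integral_cmult) measurable
  finally show ?thesis .
qed

text \<open>Apply \<open>1 + p V\<^sub>0\<close> to the hypothesis: by the resolvent identity this operator inverts \<open>1 - p V\<^sub>p\<close>.\<close>

lemma potential_absorb:
  fixes D b :: "real \<times> 'a::euclidean_space \<Rightarrow> ennreal"
  assumes [measurable]: "D \<in> borel_measurable borel" "b \<in> borel_measurable borel"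
    and p: "0 \<le> p"
    and le: "\<And>Q. fst Q \<le> T \<Longrightarrow> D Q \<le> b Q + ennreal p * potential p D Q"
    and fin: "potential 0 D P < \<infinity>" and P: "fst P \<le> T"
  shows "D P \<le> b P + ennreal p * potential 0 b P"
proof -
  have "ennreal p * potential 0 D P + D P
    \<le> ennreal p * potential 0 (\<lambda>Q. b Q + ennreal p * potential p D Q) P + (b P + ennreal p * potential p D P)"
    using P by (intro add_mono mult_left_mono potential_mono le) auto
  also have "\<dots> = ennreal p * (potential p D P + ennreal p * potential 0 (potential p D) P)
      + (b P + ennreal p * potential 0 b P)"
    by (simp add: potential_add potential_cmult distrib_left ac_simps)
  \<comment> \<open>The two terms in \<open>D\<close> are the resolvent expansion of
    \<open>potential 0 D P\<close>; being finite, it cancels against the left side.\<close>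
  also have "\<dots> = ennreal p * potential 0 D P + (b P + ennreal p * potential 0 b P)"
    by (simp add: potential_resolvent[OF _ p, symmetric])
  finally show ?thesis
    using fin by (auto simp: ennreal_add_left_cancel_le ennreal_mult_eq_top_iff)
qed

text \<open>Weighting by \<open>exp (- p * t)\<close> turns \<open>potential 0\<close> into
  \<open>potential p\<close>, so the weighted function satisfies the hypothesis of
  \<open>potential_absorb\<close> with \<open>b = 0\<close>.\<close>

lemma potential_Gronwall:
  fixes h :: "real \<times> 'a::euclidean_space \<Rightarrow> ennreal"
  assumes [measurable]: "h \<in> borel_measurable borel" and p: "0 \<le> p"
    and h0: "\<And>Q. fst Q < 0 \<Longrightarrow> h Q = 0"
    and le: "\<And>Q. fst Q \<le> T \<Longrightarrow> h Q \<le> ennreal p * potential 0 h Q"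
    and fin: "potential 0 h P < \<infinity>" and P: "fst P \<le> T"
  shows "h P = 0"
proof -
  define D where "D Q = ennreal (exp (- p * fst Q)) * h Q" for Q
  have [measurable]: "D \<in> borel_measurable borel"
    unfolding D_def[abs_def] by measurable
  have D: "potential p D Q = ennreal (exp (- p * fst Q)) * potential 0 h Q" for Q
  proof -
    have "potential p D Q = (\<integral>\<^sup>+R. ennreal (exp (- p * fst Q)) * (ennreal (causal_kernel 0 (Q - R)) * h R) \<partial>lborel)"
      unfolding potential_def D_def
    proof (rule nn_integral_cong)
      fix R
      have "causal_kernel p (Q - R) * exp (- p * fst R) = exp (- p * fst Q) * causal_kernel 0 (Q - R)"
        by (subst causal_kernel_eq) (simp add: algebra_simps flip: exp_add)
      then have "ennreal (causal_kernel p (Q - R)) * ennreal (exp (- p * fst R))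
          = ennreal (exp (- p * fst Q)) * ennreal (causal_kernel 0 (Q - R))"
        by (simp flip: ennreal_mult')
      then show "ennreal (causal_kernel p (Q - R)) * (ennreal (exp (- p * fst R)) * h R)
        = ennreal (exp (- p * fst Q)) * (ennreal (causal_kernel 0 (Q - R)) * h R)"
        by (simp add: mult.assoc[symmetric])
    qed
    also have "\<dots> = ennreal (exp (- p * fst Q)) * potential 0 h Q"
      unfolding potential_def by (rule nn_integral_cmult) measurable
    finally show ?thesis .
  qed
  \<comment> \<open>The weight is at most 1 at nonnegative times and \<open>h\<close> vanishes
    before them, so finiteness passes from \<open>h\<close> to \<open>D\<close>.\<close>
  have "D Q \<le> h Q" for Q
  proof (cases "fst Q < 0")
    case False
    then have "ennreal (exp (- p * fst Q)) * h Q \<le> 1 * h Q"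
      using p by (intro mult_right_mono) (auto simp: ennreal_le_1)
    then show ?thesis
      by (simp add: D_def)
  qed (simp add: D_def h0)
  then have "potential 0 D P \<le> potential 0 h P"
    by (intro potential_mono)
  with fin have finD: "potential 0 D P < \<infinity>"
    by (rule le_less_trans[rotated])
  have "D P \<le> 0 + ennreal p * potential 0 (\<lambda>_. 0) P"
  proof (rule potential_absorb[OF _ _ p _ finD P])
    fix Q :: "real \<times> 'a"
    assume "fst Q \<le> T"
    then have "ennreal (exp (- p * fst Q)) * h Q \<le> ennreal (exp (- p * fst Q)) * (ennreal p * potential 0 h Q)"
      by (intro mult_left_mono le) auto
    then show "D Q \<le> 0 + ennreal p * potential p D Q"
      by (simp add: D) (simp add: D_def mult.left_commute)
  qed auto
  then show ?thesis
    by (simp add: D_def potential_def)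
qed

section \<open>The domination principle\<close>

lemma mult_exp_minus_le_1: "y * exp (- y) \<le> (1::real)"
proof -
  have "y \<le> exp y"
    using exp_ge_add_one_self[of y] by linarith
  then show ?thesis
    by (simp add: exp_minus divide_simps flip: divide_inverse)
qed

text \<open>The spare factor of \<open>heat_kernel_double\<close> pays for
  \<open>norm \<xi> ^ 2\<close> through \<open>y * exp (- y) \<le> 1\<close>. The factor
  \<open>\<sigma>\<close> gained here compensates the \<open>1 / \<sigma>\<close> of
  \<open>nat_mult_exp_le\<close>.\<close>

lemma heat_kernel_norm_square_le:
  fixes \<xi> :: "'a::euclidean_space"
  assumes "0 < \<sigma>"
  shows "norm \<xi> ^ 2 * heat_kernel \<sigma> \<xi> \<le> 4 * 2 powr (real DIM('a) / 2) * (\<sigma> * heat_kernel (2 * \<sigma>) \<xi>)"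
proof -
  define y where "y = norm \<xi> ^ 2 / (4 * \<sigma>)"
  define k where "k = 2 powr (real DIM('a) / 2) * heat_kernel (2 * \<sigma>) \<xi>"
  have "norm \<xi> ^ 2 * heat_kernel \<sigma> \<xi> = 4 * \<sigma> * y * (k * exp (- y))"
    using assms by (simp add: heat_kernel_double[OF assms] k_def y_def)
  also have "\<dots> = 4 * \<sigma> * k * (y * exp (- y))"
    by simp
  also have "\<dots> \<le> 4 * \<sigma> * k * 1"
    using assms by (intro mult_left_mono mult_exp_minus_le_1) (auto simp: k_def)
  finally show ?thesis
    by (simp add: k_def ac_simps)
qed

lemma nat_mult_exp_le:
  assumes "0 < \<sigma>"
  shows "real n * exp (- real n * \<sigma>) \<le> 1 / \<sigma>"
proof -
  have "real n * \<sigma> * exp (- (real n * \<sigma>)) \<le> 1"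
    by (rule mult_exp_minus_le_1)
  then show ?thesis
    using assms by (simp add: field_simps)
qed

lemma nat_mult_exp_tendsto_0:
  assumes "0 < (\<sigma>::real)"
  shows "(\<lambda>n. real n * exp (- real n * \<sigma>)) \<longlonglongrightarrow> 0"
  using assms by real_asymp

text \<open>For large \<open>n\<close>, \<open>n * causal_kernel n (Q - R)\<close> is an approximate
  identity concentrating at \<open>R\<close> from later times, while \<open>N\<close> stays
  \<open>\<delta>\<close> away there. Dominated convergence handles the weight towards
  \<open>P\<close>, which is singular at \<open>P\<close>.\<close>

lemma causal_kernel_concentration:
  fixes P R :: "real \<times> 'a::euclidean_space"
  assumes [measurable]: "N \<in> sets borel" and "0 < \<delta>"
    and N: "\<And>Q. Q \<in> N \<Longrightarrow> fst R < fst Q \<Longrightarrow> \<delta> \<le> dist Q R"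
  shows "(\<lambda>n. \<integral>\<^sup>+Q. ennreal (causal_kernel 0 (P - Q) * indicator N Q * (real n * causal_kernel (real n) (Q - R))) \<partial>lborel)
    \<longlonglongrightarrow> 0"
proof (cases "fst R < fst P")
  case False
  then have "causal_kernel 0 (P - Q) * indicator N Q * (real n * causal_kernel (real n) (Q - R)) = 0" for Q n
    by (auto simp: causal_kernel_def)
  then show ?thesis
    by (simp only:) simp
next
  case True
  define \<tau> where "\<tau> = fst P - fst R"
  \<comment> \<open>For elapsed times below \<open>\<epsilon>\<close>, \<open>Q\<close> is at least
    \<open>\<tau> / 2\<close> before \<open>P\<close>, so the kernel towards \<open>P\<close> is at
    most \<open>c\<close>; and on \<open>N\<close> the spatial displacement from \<open>R\<close> is
    at least \<open>\<delta> / 2\<close>.\<close>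
  define \<epsilon> where "\<epsilon> = min (\<delta> / 2) (\<tau> / 2)"
  define c where "c = (pi * \<tau>) powr (- (real DIM('a)) / 2)"
  define C where "C = c * (4 / \<delta>\<^sup>2) * (4 * 2 powr (real DIM('a) / 2))"
  have \<tau>: "0 < \<tau>" and \<epsilon>: "0 < \<epsilon>"
    using True \<open>0 < \<delta>\<close> by (auto simp: \<tau>_def \<epsilon>_def)
  have C: "0 \<le> C"
    by (simp add: C_def c_def)
  define k where "k Q = indicator {0<..<\<epsilon>} (fst Q) * heat_kernel (2 * fst Q) (snd Q)" for Q :: "real \<times> 'a"
  \<comment> \<open>The first summand dominates elapsed times of at least \<open>\<epsilon>\<close>,
    the second the shorter ones.\<close>
  define w where "w Q = (1 / \<epsilon>) * (causal_kernel 0 (P - Q) * causal_kernel 0 (Q - R)) + C * k (Q - R)" for Q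
  have k0: "0 \<le> k Q" for Q
    by (simp add: k_def)
  have [measurable]: "(\<lambda>w. k (f w)) \<in> borel_measurable M" if [measurable]: "f \<in> borel_measurable M"
    for f and M :: "'z measure"
    unfolding k_def by measurable
  have w_meas[measurable]: "w \<in> borel_measurable borel"
    unfolding w_def[abs_def] by measurable
  have far: "causal_kernel 0 (P - Q) \<le> c" if "fst (Q - R) < \<epsilon>" for Q
  proof -
    have t: "\<tau> / 2 \<le> fst (P - Q)"
      using that by (simp add: \<tau>_def \<epsilon>_def min_def split: if_splits)
    have "(2 * pi * fst (P - Q)) powr (- (real DIM('a)) / 2) \<le> c"
      unfolding c_def using t \<tau> by (intro powr_mono2') auto
    moreover have "exp (- (norm (snd (P - Q)) ^ 2) / (2 * fst (P - Q))) \<le> 1"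
      using t \<tau> by (simp add: divide_nonneg_nonneg)
    ultimately have "heat_kernel (fst (P - Q)) (snd (P - Q)) \<le> c * 1"
      unfolding heat_kernel_def by (intro mult_mono) (auto simp: c_def)
    then show ?thesis
      using t \<tau> by (simp add: causal_kernel_def)
  qed
  have bound: "causal_kernel 0 (P - Q) * indicator N Q * (real n * causal_kernel (real n) (Q - R)) \<le> w Q" for Q n
  proof (cases "Q \<in> N \<and> 0 < fst (Q - R)")
    case False
    then show ?thesis
      using \<epsilon> C k0[of "Q - R"] by (auto simp: w_def causal_kernel_eq_0 indicator_def)
  next
    case True
    define \<sigma> \<xi> where "\<sigma> = fst (Q - R)" and "\<xi> = snd (Q - R)"
    have \<sigma>: "0 < \<sigma>"
      using True by (simp add: \<sigma>_def)
    have QR: "Q - R = (\<sigma>, \<xi>)"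
      by (simp add: \<sigma>_def \<xi>_def prod_eq_iff)
    have le1: "real n * causal_kernel (real n) (Q - R) \<le> (1 / \<sigma>) * heat_kernel \<sigma> \<xi>"
    proof -
      have "real n * exp (- real n * \<sigma>) * heat_kernel \<sigma> \<xi> \<le> 1 / \<sigma> * heat_kernel \<sigma> \<xi>"
        using nat_mult_exp_le[OF \<sigma>] by (intro mult_right_mono) auto
      then show ?thesis
        using \<sigma> by (simp add: QR causal_kernel_def)
    qed
    show ?thesis
    proof (cases "\<epsilon> \<le> \<sigma>")
      case True
      have "(1 / \<sigma>) * heat_kernel \<sigma> \<xi> \<le> (1 / \<epsilon>) * heat_kernel \<sigma> \<xi>"
        using True \<epsilon> by (intro mult_right_mono) (auto simp: frac_le)
      with le1 have "real n * causal_kernel (real n) (Q - R) \<le> (1 / \<epsilon>) * causal_kernel 0 (Q - R)"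
        using \<sigma> by (simp add: QR causal_kernel_def)
      then have "causal_kernel 0 (P - Q) * (real n * causal_kernel (real n) (Q - R))
          \<le> causal_kernel 0 (P - Q) * ((1 / \<epsilon>) * causal_kernel 0 (Q - R))"
        by (intro mult_left_mono) auto
      moreover have "0 \<le> C * k (Q - R)"
        using C k0 by simp
      ultimately show ?thesis
        using \<open>Q \<in> N \<and> _\<close> by (simp add: w_def ac_simps)
    next
      case False
      have "\<delta> \<le> norm (Q - R)"
        using N[of Q] True by (simp add: dist_norm)
      also have "\<dots> \<le> \<sigma> + norm \<xi>"
        using norm_Pair_le[of \<sigma> \<xi>] \<sigma> by (simp add: QR)
      finally have "\<delta> / 2 \<le> norm \<xi>"
        using False by (auto simp: \<epsilon>_def min_def split: if_splits)
      then have "(\<delta> / 2)\<^sup>2 \<le> norm \<xi> ^ 2"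
        using \<open>0 < \<delta>\<close> by (intro power_mono) auto
      then have "1 \<le> (4 / \<delta>\<^sup>2) * norm \<xi> ^ 2"
        using \<open>0 < \<delta>\<close> by (simp add: field_simps power2_eq_square)
      then have "1 * heat_kernel \<sigma> \<xi> \<le> (4 / \<delta>\<^sup>2) * norm \<xi> ^ 2 * heat_kernel \<sigma> \<xi>"
        by (intro mult_right_mono) auto
      also have "\<dots> \<le> (4 / \<delta>\<^sup>2) * (4 * 2 powr (real DIM('a) / 2) * (\<sigma> * heat_kernel (2 * \<sigma>) \<xi>))"
        unfolding mult.assoc[of "4 / \<delta>\<^sup>2"]
        using heat_kernel_norm_square_le[OF \<sigma>, of \<xi>] by (intro mult_left_mono) auto
      finally have "(1 / \<sigma>) * heat_kernel \<sigma> \<xi>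
          \<le> (1 / \<sigma>) * ((4 / \<delta>\<^sup>2) * (4 * 2 powr (real DIM('a) / 2) * (\<sigma> * heat_kernel (2 * \<sigma>) \<xi>)))"
        using \<sigma> by (intro mult_left_mono) auto
      also have "\<dots> = (4 / \<delta>\<^sup>2) * (4 * 2 powr (real DIM('a) / 2)) * heat_kernel (2 * \<sigma>) \<xi>"
        using \<sigma> by simp
      finally have le2: "real n * causal_kernel (real n) (Q - R)
          \<le> (4 / \<delta>\<^sup>2) * (4 * 2 powr (real DIM('a) / 2)) * heat_kernel (2 * \<sigma>) \<xi>"
        using le1 by simp
      have "causal_kernel 0 (P - Q) * (real n * causal_kernel (real n) (Q - R))
          \<le> c * ((4 / \<delta>\<^sup>2) * (4 * 2 powr (real DIM('a) / 2)) * heat_kernel (2 * \<sigma>) \<xi>)"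
        by (rule mult_mono[OF far le2]) (use False in \<open>auto simp: \<sigma>_def c_def\<close>)
      also have "\<dots> = C * k (Q - R)"
        using False \<sigma> by (simp add: C_def k_def QR ac_simps)
      finally have "causal_kernel 0 (P - Q) * (real n * causal_kernel (real n) (Q - R)) \<le> C * k (Q - R)" .
      moreover have "0 \<le> (1 / \<epsilon>) * (causal_kernel 0 (P - Q) * causal_kernel 0 (Q - R))"
        using \<epsilon> by simp
      ultimately show ?thesis
        using True unfolding w_def by simp
    qed
  qed
  \<comment> \<open>The first summand of \<open>w\<close> integrates to a multiple of a finite
    kernel convolution, the second to \<open>C * \<epsilon>\<close>.\<close>
  have fin: "(\<integral>\<^sup>+Q. ennreal (w Q) \<partial>lborel) < \<infinity>"
  proof -
    have "(\<integral>\<^sup>+Q. ennreal (w Q) \<partial>lborel)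
      = (\<integral>\<^sup>+Q. ennreal (1 / \<epsilon>) * (ennreal (causal_kernel 0 (P - Q)) * ennreal (causal_kernel 0 (Q - R)))
           + ennreal C * ennreal (k (Q - R)) \<partial>lborel)"
      using \<epsilon> C k0 by (simp add: w_def ennreal_plus ennreal_mult' del: times_divide_eq_left)
    also have "\<dots> = ennreal (1 / \<epsilon>) * (\<integral>\<^sup>+Q. ennreal (causal_kernel 0 (P - Q)) * ennreal (causal_kernel 0 (Q - R)) \<partial>lborel)
           + ennreal C * (\<integral>\<^sup>+Q. ennreal (k (Q - R)) \<partial>lborel)"
      by (subst nn_integral_add) (simp_all add: nn_integral_cmult)
    also have "(\<integral>\<^sup>+Q. ennreal (causal_kernel 0 (P - Q)) * ennreal (causal_kernel 0 (Q - R)) \<partial>lborel)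
      = (\<integral>\<^sup>+Q. ennreal (causal_kernel 0 (P - R - Q)) * ennreal (causal_kernel 0 Q) \<partial>lborel)"
      by (subst nn_integral_lborel_translate[where a = R, symmetric]) (auto simp: algebra_simps)
    also have "\<dots> = ennreal (causal_kernel 0 (P - R)) * ennreal \<tau>"
      unfolding causal_kernel_convolution using \<tau> by (simp add: \<tau>_def)
    also have "(\<integral>\<^sup>+Q. ennreal (k (Q - R)) \<partial>lborel) = (\<integral>\<^sup>+Q. ennreal (k Q) \<partial>lborel)"
      by (subst nn_integral_lborel_translate[where a = R, symmetric]) auto
    also have "\<dots> = (\<integral>\<^sup>+\<sigma>. \<integral>\<^sup>+\<xi>. ennreal (k (\<sigma>, \<xi>)) \<partial>lborel \<partial>lborel)"
      by (rule nn_integral_lborel_pair) measurable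
    also have "\<dots> = (\<integral>\<^sup>+\<sigma>. indicator {0<..<\<epsilon>} \<sigma> \<partial>lborel)"
    proof (rule nn_integral_cong)
      fix \<sigma> :: real
      show "(\<integral>\<^sup>+\<xi>. ennreal (k (\<sigma>, \<xi>)) \<partial>lborel) = indicator {0<..<\<epsilon>} \<sigma>"
        by (cases "\<sigma> \<in> {0<..<\<epsilon>}") (simp_all add: k_def nn_integral_heat_kernel)
    qed
    also have "\<dots> = ennreal \<epsilon>"
      using \<epsilon> by simp
    finally show ?thesis
      by (simp add: ennreal_mult_less_top)
  qed
  have "(\<lambda>n. \<integral>\<^sup>+Q. ennreal (causal_kernel 0 (P - Q) * indicator N Q * (real n * causal_kernel (real n) (Q - R))) \<partial>lborel)
    \<longlonglongrightarrow> (\<integral>\<^sup>+(Q :: real \<times> 'a). 0 \<partial>lborel)"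
  proof (rule nn_integral_dominated_convergence[where w = "\<lambda>Q. ennreal (w Q)", OF _ _ _ _ fin])
    show "AE Q in lborel. ennreal (causal_kernel 0 (P - Q) * indicator N Q * (real n * causal_kernel (real n) (Q - R)))
        \<le> ennreal (w Q)" for n
      using bound by (intro always_eventually allI ennreal_leI)
    show "AE Q in lborel. (\<lambda>n. ennreal (causal_kernel 0 (P - Q) * indicator N Q * (real n * causal_kernel (real n) (Q - R)))) \<longlonglongrightarrow> 0"
    proof (intro always_eventually allI)
      fix Q
      have "(\<lambda>n. real n * causal_kernel (real n) (Q - R)) \<longlonglongrightarrow> 0"
      proof (cases "0 < fst (Q - R)")
        case True
        then have "(\<lambda>n. (real n * exp (- real n * fst (Q - R))) * heat_kernel (fst (Q - R)) (snd (Q - R))) \<longlonglongrightarrow> 0"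
          by (intro tendsto_mult_left_zero nat_mult_exp_tendsto_0)
        with True show ?thesis
          by (simp add: causal_kernel_def mult.assoc)
      next
        case False
        then show ?thesis
          by (simp add: causal_kernel_eq_0)
      qed
      then have "(\<lambda>n. causal_kernel 0 (P - Q) * indicator N Q * (real n * causal_kernel (real n) (Q - R))) \<longlonglongrightarrow> 0"
        by (rule tendsto_mult_right_zero)
      then show "(\<lambda>n. ennreal (causal_kernel 0 (P - Q) * indicator N Q * (real n * causal_kernel (real n) (Q - R)))) \<longlonglongrightarrow> 0"
        using tendsto_ennrealI by fastforce
    qed
  qed auto
  then show ?thesis
    by simp
qed

text \<open>Domination principle: it replaces Kato's inequality for the positive part of a mild solution and
  needs no regularity beyond the integrability of the potentials.\<close>

lemma potential_domination:
  fixes a c e :: "real \<times> 'a::euclidean_space \<Rightarrow> ennreal"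
  assumes [measurable]: "a \<in> borel_measurable borel" "c \<in> borel_measurable borel" "e \<in> borel_measurable borel"
    and a0: "\<And>Q. fst Q < 0 \<Longrightarrow> a Q = 0"
    and fin: "\<And>Q. fst Q \<le> T \<Longrightarrow> potential 0 a Q < \<infinity>"
    and exc: "\<And>n Q. fst Q \<le> T \<Longrightarrow> ennreal (real n) * potential (real n) e Q \<le> e Q"
    and near: "\<And>R. a R \<noteq> 0 \<Longrightarrow> fst R < T \<Longrightarrow> \<exists>\<delta>>0. \<forall>Q. fst R < fst Q \<longrightarrow> fst Q \<le> T \<longrightarrow> dist Q R < \<delta> \<longrightarrow>
              potential 0 a Q \<le> potential 0 c Q + e Q"
    and P: "fst P \<le> T"
  shows "potential 0 a P \<le> potential 0 c P + e P"
proof -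
  define U where "U = potential 0 a"
  define W where "W Q = potential 0 c Q + e Q" for Q
  \<comment> \<open>Subtraction in \<open>ennreal\<close> is truncated: \<open>D\<close> is the
    positive part of \<open>U - W\<close>, and the goal becomes \<open>D P = 0\<close>.\<close>
  define D where "D Q = U Q - W Q" for Q
  have [measurable]: "U \<in> borel_measurable borel" "W \<in> borel_measurable borel" "D \<in> borel_measurable borel"
    unfolding U_def W_def[abs_def] D_def[abs_def] by measurable
  define N where "N = {Q. fst Q \<le> T \<and> 0 < D Q}"
  have [measurable]: "N \<in> sets borel"
    unfolding N_def by measurable
  \<comment> \<open>The source term \<open>potential n a\<close>, restricted to the bad set
    \<open>N\<close> where the claim fails.\<close>
  define b where "b n Q = indicator N Q * potential (real n) a Q" for n :: nat and Q
  have [measurable]: "b n \<in> borel_measurable borel" for n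
    unfolding b_def[abs_def] by measurable
  have finD: "potential 0 D P < \<infinity>"
  proof -
    have "potential 0 D P \<le> potential 0 U P"
      by (rule potential_mono) (simp add: D_def diff_le_self_ennreal)
    also have "\<dots> \<le> ennreal (fst P) * potential 0 a P"
      unfolding U_def by (rule potential_potential_le) (use a0 in auto)
    also have "\<dots> < \<infinity>"
      using fin[OF P] by (simp add: ennreal_mult_less_top)
    finally show ?thesis .
  qed
  \<comment> \<open>On \<open>N\<close>, expand \<open>U\<close> by the commuted resolvent identity
    and use that \<open>W\<close> is excessive: the excess over \<open>W\<close> is fed only by
    \<open>potential n a\<close> and by \<open>D\<close> itself. Off \<open>N\<close>,
    \<open>D\<close> vanishes.\<close>
  have step: "D Q \<le> b n Q + ennreal (real n) * potential (real n) D Q" if Q: "fst Q \<le> T" for n Q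
  proof (cases "Q \<in> N")
    case False
    then show ?thesis
      using Q by (simp add: N_def)
  next
    case True
    let ?p = "real n"
    have le_add_diff: "x \<le> y + (x - y)" for x y :: ennreal
    proof (cases "y \<le> x")
      case True
      then show ?thesis
        by (simp add: add_diff_inverse_ennreal)
    next
      case False
      then show ?thesis
        by (intro add_increasing2) auto
    qed
    have resolvent: "potential 0 h Q = potential ?p h Q + ennreal ?p * potential ?p (potential 0 h) Q"
      if "h \<in> borel_measurable borel" for h
      using potential_resolvent[OF that, of ?p Q] potential_commute[OF that, of 0 ?p Q] by simp
    have W: "ennreal ?p * potential ?p W Q \<le> W Q"
    proof -
      have "ennreal ?p * potential ?p W Q
        = ennreal ?p * potential ?p (potential 0 c) Q + ennreal ?p * potential ?p e Q"
        unfolding W_def[abs_def] by (simp add: potential_add distrib_left)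
      also have "\<dots> \<le> potential 0 c Q + e Q"
        using resolvent[of c] by (intro add_mono exc Q) auto
      finally show ?thesis
        by (simp add: W_def)
    qed
    have "U Q = potential ?p a Q + ennreal ?p * potential ?p U Q"
      unfolding U_def by (rule resolvent) measurable
    also have "\<dots> \<le> potential ?p a Q + ennreal ?p * potential ?p (\<lambda>Q. W Q + D Q) Q"
      by (intro add_left_mono mult_left_mono potential_mono) (auto simp: D_def le_add_diff)
    also have "\<dots> = ennreal ?p * potential ?p W Q + (potential ?p a Q + ennreal ?p * potential ?p D Q)"
      by (simp add: potential_add distrib_left ac_simps)
    also have "\<dots> \<le> W Q + (potential ?p a Q + ennreal ?p * potential ?p D Q)"
      by (intro add_right_mono W)
    finally have "U Q - W Q \<le> potential ?p a Q + ennreal ?p * potential ?p D Q"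
      using fin[OF Q] by (auto simp: ennreal_minus_le_iff U_def)
    with True show ?thesis
      by (simp add: b_def D_def)
  qed
  \<comment> \<open>Absorbing the term in \<open>D\<close> leaves one bound for each
    \<open>n\<close>; the rest of the proof shows that its right side tends to zero.\<close>
  have D_le: "D P \<le> b n P + ennreal (real n) * potential 0 (b n) P" for n
    by (rule potential_absorb[OF _ _ _ step finD P]) auto
  have kernel_le: "ennreal (causal_kernel (real n) (P - R)) * a R \<le> ennreal (causal_kernel 0 (P - R)) * a R" for n R
  proof -
    have "causal_kernel (real n) (P - R) \<le> causal_kernel 0 (P - R)"
      by (cases "0 < fst (P - R)") (auto simp: causal_kernel_def mult_left_le_one_le)
    then show ?thesis
      by (intro mult_right_mono ennreal_leI) auto
  qed
  have Va: "(\<integral>\<^sup>+R. ennreal (causal_kernel 0 (P - R)) * a R \<partial>lborel) < \<infinity>"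
    using fin[OF P] by (simp add: potential_def)
  \<comment> \<open>Multiplying a null sequence by \<open>a R\<close> needs \<open>a R\<close>
    finite; off a null set, the kernel vanishes wherever it is not.\<close>
  have fin_a: "AE R in lborel. a R < \<infinity> \<or> causal_kernel 0 (P - R) = 0"
    using nn_integral_noteq_infinite[OF _ Va[THEN less_imp_neq]]
    by (auto elim!: eventually_mono simp: ennreal_mult_eq_top_iff less_top)
  have b_lim: "(\<lambda>n. b n P) \<longlonglongrightarrow> 0"
  proof -
    have "(\<lambda>n. potential (real n) a P) \<longlonglongrightarrow> (\<integral>\<^sup>+R. (\<lambda>_. 0) (R :: real \<times> 'a) \<partial>lborel)"
      unfolding potential_def
    proof (rule nn_integral_dominated_convergence[OF _ _ _ _ Va])
      show "AE R in lborel. (\<lambda>n. ennreal (causal_kernel (real n) (P - R)) * a R) \<longlonglongrightarrow> 0"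
        using fin_a
      proof (rule eventually_mono)
        fix R
        assume R: "a R < \<infinity> \<or> causal_kernel 0 (P - R) = 0"
        show "(\<lambda>n. ennreal (causal_kernel (real n) (P - R)) * a R) \<longlonglongrightarrow> 0"
        proof (cases "causal_kernel 0 (P - R) = 0")
          case True
          then show ?thesis
            by (subst causal_kernel_eq) simp
        next
          case False
          then have "0 < fst (P - R)"
            using causal_kernel_eq_0[of "P - R" 0] by linarith
          then have "(\<lambda>n. exp (- real n * fst (P - R))) \<longlonglongrightarrow> 0"
            by real_asymp
          then have "(\<lambda>n. causal_kernel (real n) (P - R)) \<longlonglongrightarrow> 0"
            by (subst causal_kernel_eq) (rule tendsto_mult_left_zero)
          then have "(\<lambda>n. ennreal (causal_kernel (real n) (P - R))) \<longlonglongrightarrow> ennreal 0"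
            by (rule tendsto_ennrealI)
          then have "(\<lambda>n. a R * ennreal (causal_kernel (real n) (P - R))) \<longlonglongrightarrow> a R * ennreal 0"
            using R False by (intro ennreal_tendsto_cmult) auto
          then show ?thesis
            by (simp add: mult.commute)
        qed
      qed
    qed (use kernel_le in auto)
    then have lim: "(\<lambda>n. potential (real n) a P) \<longlonglongrightarrow> 0"
      by simp
    show ?thesis
      by (rule tendsto_sandwich[OF _ _ tendsto_const lim]) (auto simp: b_def split: split_indicator)
  qed
  \<comment> \<open>After Tonelli, \<open>\<mu> n R\<close> is the mass that the approximate
    identity at \<open>R\<close> leaves on \<open>N\<close>, weighted by the kernel towards
    \<open>P\<close>.\<close>
  define \<mu> where "\<mu> n R = (\<integral>\<^sup>+Q. ennreal (causal_kernel 0 (P - Q) * indicator N Q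
      * (real n * causal_kernel (real n) (Q - R))) \<partial>lborel)" for n and R :: "real \<times> 'a"
  have [measurable]: "\<mu> n \<in> borel_measurable borel" for n
    unfolding \<mu>_def[abs_def] by measurable
  have Vb: "ennreal (real n) * potential 0 (b n) P = (\<integral>\<^sup>+R. \<mu> n R * a R \<partial>lborel)" for n
  proof -
    have "ennreal (real n) * potential 0 (b n) P = (\<integral>\<^sup>+Q. \<integral>\<^sup>+R. ennreal (causal_kernel 0 (P - Q) * indicator N Q
      * (real n * causal_kernel (real n) (Q - R))) * a R \<partial>lborel \<partial>lborel)"
      unfolding potential_def b_def
      by (simp add: nn_integral_cmult[symmetric] ennreal_mult' ennreal_indicator ac_simps)
    also have "\<dots> = (\<integral>\<^sup>+R. \<integral>\<^sup>+Q. ennreal (causal_kernel 0 (P - Q) * indicator N Q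
      * (real n * causal_kernel (real n) (Q - R))) * a R \<partial>lborel \<partial>lborel)"
      by (rule lborel_pair.Fubini') measurable
    also have "\<dots> = (\<integral>\<^sup>+R. \<mu> n R * a R \<partial>lborel)"
      unfolding \<mu>_def by (simp add: nn_integral_multc)
    finally show ?thesis .
  qed
  \<comment> \<open>Dropping the indicator of \<open>N\<close> leaves one term of the resolvent
    identity, hence a majorant independent of \<open>n\<close>.\<close>
  have \<mu>_le: "\<mu> n R \<le> ennreal (causal_kernel 0 (P - R))" for n R
  proof -
    have "\<mu> n R \<le> (\<integral>\<^sup>+Q. ennreal (real n) * (ennreal (causal_kernel 0 (P - Q)) * ennreal (causal_kernel (real n) (Q - R))) \<partial>lborel)"
      unfolding \<mu>_def
      by (intro nn_integral_mono) (simp add: ennreal_mult' ac_simps split: split_indicator)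
    also have "\<dots> = ennreal (real n) * (\<integral>\<^sup>+Q. ennreal (causal_kernel 0 (P - Q)) * ennreal (causal_kernel (real n) (Q - R)) \<partial>lborel)"
      by (rule nn_integral_cmult) measurable
    also have "(\<integral>\<^sup>+Q. ennreal (causal_kernel 0 (P - Q)) * ennreal (causal_kernel (real n) (Q - R)) \<partial>lborel)
      = (\<integral>\<^sup>+Q. ennreal (causal_kernel 0 (P - R - Q)) * ennreal (causal_kernel (real n) Q) \<partial>lborel)"
      by (subst nn_integral_lborel_translate[where a = R, symmetric]) (auto simp: algebra_simps)
    also have "ennreal (real n) * \<dots> \<le> ennreal (causal_kernel 0 (P - R))"
      by (subst (2) causal_kernel_resolvent[of "real n"]) auto
    finally show ?thesis .
  qed
  have Vb_lim: "(\<lambda>n. ennreal (real n) * potential 0 (b n) P) \<longlonglongrightarrow> 0"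
  proof -
    have "(\<lambda>n. \<integral>\<^sup>+R. \<mu> n R * a R \<partial>lborel) \<longlonglongrightarrow> (\<integral>\<^sup>+R. (\<lambda>_. 0) (R :: real \<times> 'a) \<partial>lborel)"
    proof (rule nn_integral_dominated_convergence[OF _ _ _ _ Va])
      show "AE R in lborel. \<mu> n R * a R \<le> ennreal (causal_kernel 0 (P - R)) * a R" for n
        by (intro always_eventually allI mult_right_mono \<mu>_le) auto
      show "AE R in lborel. (\<lambda>n. \<mu> n R * a R) \<longlonglongrightarrow> 0"
        using fin_a
      proof (rule eventually_mono)
        fix R
        assume R: "a R < \<infinity> \<or> causal_kernel 0 (P - R) = 0"
        show "(\<lambda>n. \<mu> n R * a R) \<longlonglongrightarrow> 0"
        proof (cases "a R = 0 \<or> causal_kernel 0 (P - R) = 0")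
          case True
          then have "\<mu> n R * a R = 0" for n
            using \<mu>_le[of n R] by auto
          then show ?thesis
            by (simp only:) simp
        next
          case False
          then have "0 < fst (P - R)"
            using causal_kernel_eq_0[of "P - R" 0] by linarith
          \<comment> \<open>Where \<open>a\<close> is nonzero, \<open>near\<close> keeps the later
            points of \<open>N\<close> away from \<open>R\<close>, so the concentration lemma
            applies.\<close>
          then obtain \<delta> where \<delta>: "0 < \<delta>" "\<And>Q. fst R < fst Q \<Longrightarrow> fst Q \<le> T \<Longrightarrow> dist Q R < \<delta> \<Longrightarrow> U Q \<le> W Q"
            using near[of R] False P unfolding U_def W_def by auto
          have "(\<lambda>n. \<mu> n R) \<longlonglongrightarrow> 0"
            unfolding \<mu>_def
          proof (rule causal_kernel_concentration[OF _ \<delta>(1)])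
            fix Q
            assume Q: "Q \<in> N" "fst R < fst Q"
            then have "\<not> U Q \<le> W Q"
              using fin[of Q] by (auto simp: N_def D_def U_def zero_less_iff_neq_zero diff_eq_0_iff_ennreal)
            with Q \<delta>(2)[of Q] show "\<delta> \<le> dist Q R"
              by (auto simp: N_def not_less[symmetric])
          qed measurable
          then have "(\<lambda>n. a R * \<mu> n R) \<longlonglongrightarrow> a R * 0"
            using R False by (intro ennreal_tendsto_cmult) auto
          then show ?thesis
            by (simp add: mult.commute)
        qed
      qed
    qed auto
    then show ?thesis
      by (simp add: Vb)
  qed
  have "(\<lambda>n. b n P + ennreal (real n) * potential 0 (b n) P) \<longlonglongrightarrow> 0 + 0"
    by (intro tendsto_add b_lim Vb_lim)
  then have "D P \<le> 0 + 0"
    by (rule tendsto_lowerbound) (use D_le in auto)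
  then have "U P - W P = 0"
    by (simp add: D_def)
  then have "U P \<le> W P"
    using fin[OF P] by (simp add: U_def diff_eq_0_iff_ennreal)
  then show ?thesis
    by (simp add: U_def W_def)
qed

section \<open>The heat flow of a polynomial weight\<close>

definition poly_weight :: "real \<Rightarrow> 'a::euclidean_space \<Rightarrow> 'a \<Rightarrow> real" where
  "poly_weight \<theta> x0 x = 1 + norm (x - x0) powr \<theta>"

text \<open>The heat semigroup applied to the weight, written as an expectation so that it is continuous and
  takes the right value at time \<open>0\<close>, where the heat kernel itself degenerates.\<close>

definition heat_flow :: "real \<Rightarrow> 'a::euclidean_space \<Rightarrow> real \<times> 'a \<Rightarrow> real" where
  "heat_flow \<theta> x0 P = (\<integral>z. heat_kernel 1 z * poly_weight \<theta> x0 (snd P + sqrt (fst P) *\<^sub>R z) \<partial>lborel)"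

lemma poly_weight_ge_1: "1 \<le> poly_weight \<theta> x0 x"
  by (simp add: poly_weight_def)

lemma poly_weight_nonneg [simp]: "0 \<le> poly_weight \<theta> x0 x"
  using poly_weight_ge_1[of \<theta> x0 x] by linarith

lemma borel_measurable_poly_weight [measurable (raw)]:
  assumes [measurable]: "f \<in> borel_measurable M"
  shows "(\<lambda>w. poly_weight \<theta> x0 (f w)) \<in> borel_measurable M"
  unfolding poly_weight_def by measurable

section \<open>Gaussian moments, growth and continuity of the heat flow\<close>

text \<open>Combines \<open>ln r \<le> r\<close> with Young's inequality. The factor
  \<open>exp (r\<^sup>2 / 4)\<close> is exactly what \<open>heat_kernel_double\<close> can spare at
  time 1.\<close>

lemma powr_le_exp_square:
  assumes "0 < \<theta>" "0 \<le> (r::real)"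
  shows "r powr \<theta> \<le> exp (\<theta>\<^sup>2) * exp (r\<^sup>2 / 4)"
proof (cases "r = 0")
  case False
  with assms have "ln r \<le> r"
    using ln_le_minus_one[of r] by simp
  then have "\<theta> * ln r \<le> \<theta> * r"
    using assms by (intro mult_left_mono) auto
  also have "\<theta> * r \<le> \<theta>\<^sup>2 + r\<^sup>2 / 4"
  proof -
    have "0 \<le> (\<theta> - r / 2)\<^sup>2"
      by simp
    then show ?thesis
      by (simp add: power2_eq_square algebra_simps)
  qed
  finally show ?thesis
    using False by (simp add: powr_def flip: exp_add)
qed simp

text \<open>A sum is at most twice the maximum. The product form separates \<open>x\<close>,
  \<open>a\<close> and \<open>z\<close>, so that the Gaussian integral in \<open>z\<close> becomes
  one fixed moment.\<close>

lemma poly_weight_shift_le: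
  fixes x z :: "'a::euclidean_space"
  assumes "0 < \<theta>"
  shows "poly_weight \<theta> x0 (x + a *\<^sub>R z)
    \<le> 2 powr \<theta> * poly_weight \<theta> x0 x * (1 + \<bar>a\<bar> powr \<theta>) * (1 + norm z powr \<theta>)"
proof -
  define u v where "u = norm (x - x0)" and "v = \<bar>a\<bar> * norm z"
  have uv: "0 \<le> u" "0 \<le> v"
    by (auto simp: u_def v_def)
  have "norm (x + a *\<^sub>R z - x0) \<le> u + v"
    using norm_triangle_ineq[of "x - x0" "a *\<^sub>R z"] by (simp add: u_def v_def algebra_simps)
  also have "\<dots> \<le> 2 * max u v"
    by auto
  finally have "norm (x + a *\<^sub>R z - x0) powr \<theta> \<le> (2 * max u v) powr \<theta>"
    using assms by (intro powr_mono2) auto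
  also have "\<dots> = 2 powr \<theta> * max u v powr \<theta>"
    by (rule powr_mult)
  also have "\<dots> \<le> 2 powr \<theta> * (u powr \<theta> + v powr \<theta>)"
    by (intro mult_left_mono) (auto simp: max_def)
  finally have 1: "norm (x + a *\<^sub>R z - x0) powr \<theta> \<le> 2 powr \<theta> * (u powr \<theta> + \<bar>a\<bar> powr \<theta> * norm z powr \<theta>)"
    by (simp add: v_def powr_mult)
  have 2: "1 \<le> (2::real) powr \<theta>"
    using assms by (simp add: ge_one_powr_ge_zero)
  have "1 + norm (x + a *\<^sub>R z - x0) powr \<theta> \<le> 2 powr \<theta> * (1 + (u powr \<theta> + \<bar>a\<bar> powr \<theta> * norm z powr \<theta>))"
    using 1 2 by (simp add: algebra_simps)
  also have "\<dots> \<le> 2 powr \<theta> * ((1 + u powr \<theta>) * (1 + \<bar>a\<bar> powr \<theta>) * (1 + norm z powr \<theta>))"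
    by (intro mult_left_mono) (auto simp: algebra_simps)
  finally show ?thesis
    by (simp add: poly_weight_def u_def mult.assoc)
qed

lemma integrable_heat_kernel_moment:
  assumes "0 < \<theta>"
  shows "integrable lborel (\<lambda>z::'a::euclidean_space. heat_kernel 1 z * (1 + norm z powr \<theta>))"
proof -
  have int: "integrable lborel (heat_kernel t :: 'a \<Rightarrow> real)" if "0 < t" for t
    using nn_integral_heat_kernel[OF that, where 'a = 'a] by (intro integrableI_nonneg) auto
  define d where "d = real DIM('a) / 2"
  define C where "C = exp (\<theta>\<^sup>2) * 2 powr d"
  show ?thesis
  proof (rule Bochner_Integration.integrable_bound)
    show "integrable lborel (\<lambda>z::'a. heat_kernel 1 z + C * heat_kernel 2 z)"
      by (intro Bochner_Integration.integrable_add integrable_mult_right int) auto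
    show "AE z::'a in lborel. norm (heat_kernel 1 z * (1 + norm z powr \<theta>)) \<le> norm (heat_kernel 1 z + C * heat_kernel 2 z)"
    proof (intro always_eventually allI)
      fix z :: 'a
      have "norm z powr \<theta> \<le> exp (\<theta>\<^sup>2) * exp ((norm z)\<^sup>2 / 4)"
        using assms by (intro powr_le_exp_square) auto
      then have "heat_kernel 1 z * norm z powr \<theta> \<le> heat_kernel 1 z * (exp (\<theta>\<^sup>2) * exp ((norm z)\<^sup>2 / 4))"
        by (intro mult_left_mono) auto
      also have "\<dots> = C * heat_kernel 2 z"
        by (simp add: C_def d_def heat_kernel_double[of 1] exp_minus)
      finally show "norm (heat_kernel 1 z * (1 + norm z powr \<theta>)) \<le> norm (heat_kernel 1 z + C * heat_kernel 2 z)"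
        by (simp add: algebra_simps abs_mult C_def)
    qed
  qed measurable
qed

lemma integrable_heat_flow:
  fixes x :: "'a::euclidean_space"
  assumes "0 < \<theta>"
  shows "integrable lborel (\<lambda>z. heat_kernel 1 z * poly_weight \<theta> x0 (x + a *\<^sub>R z))"
proof (rule Bochner_Integration.integrable_bound)
  show "integrable lborel (\<lambda>z::'a. 2 powr \<theta> * poly_weight \<theta> x0 x * (1 + \<bar>a\<bar> powr \<theta>) * (heat_kernel 1 z * (1 + norm z powr \<theta>)))"
    by (intro integrable_mult_right integrable_heat_kernel_moment assms)
  show "AE z in lborel. norm (heat_kernel 1 z * poly_weight \<theta> x0 (x + a *\<^sub>R z))
     \<le> norm (2 powr \<theta> * poly_weight \<theta> x0 x * (1 + \<bar>a\<bar> powr \<theta>) * (heat_kernel 1 z * (1 + norm z powr \<theta>)))"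
  proof (intro always_eventually allI)
    fix z :: 'a
    have "heat_kernel 1 z * poly_weight \<theta> x0 (x + a *\<^sub>R z)
      \<le> heat_kernel 1 z * (2 powr \<theta> * poly_weight \<theta> x0 x * (1 + \<bar>a\<bar> powr \<theta>) * (1 + norm z powr \<theta>))"
      by (intro mult_left_mono poly_weight_shift_le assms) auto
    then show "norm (heat_kernel 1 z * poly_weight \<theta> x0 (x + a *\<^sub>R z))
     \<le> norm (2 powr \<theta> * poly_weight \<theta> x0 x * (1 + \<bar>a\<bar> powr \<theta>) * (heat_kernel 1 z * (1 + norm z powr \<theta>)))"
      by (simp add: abs_mult ac_simps)
  qed
qed measurable

lemma heat_flow_nonneg [simp]: "0 \<le> heat_flow \<theta> x0 P"
  unfolding heat_flow_def by (intro Bochner_Integration.integral_nonneg) simp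

text \<open>\<open>K\<close> is \<open>2 powr \<theta>\<close> times a moment of the standard
  Gaussian; being chosen before \<open>x0\<close>, it makes the final constant uniform in the
  centre.\<close>

lemma heat_flow_le:
  assumes "0 < \<theta>"
  obtains K where "0 \<le> K"
    "\<And>x0 t (x::'a::euclidean_space). 0 \<le> t \<Longrightarrow> heat_flow \<theta> x0 (t, x) \<le> K * (1 + sqrt t powr \<theta>) * poly_weight \<theta> x0 x"
proof
  define m where "m = (\<integral>(z::'a). heat_kernel 1 z * (1 + norm z powr \<theta>) \<partial>lborel)"
  show "0 \<le> 2 powr \<theta> * m"
    unfolding m_def by (intro mult_nonneg_nonneg Bochner_Integration.integral_nonneg) auto
  fix x0 x :: 'a and t :: real
  assume t: "0 \<le> t"
  have "heat_flow \<theta> x0 (t, x) \<le> (\<integral>(z::'a). 2 powr \<theta> * poly_weight \<theta> x0 x * (1 + \<bar>sqrt t\<bar> powr \<theta>) * (heat_kernel 1 z * (1 + norm z powr \<theta>)) \<partial>lborel)"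
    unfolding heat_flow_def
  proof (rule integral_mono)
    fix z :: 'a
    have "heat_kernel 1 z * poly_weight \<theta> x0 (x + sqrt t *\<^sub>R z)
      \<le> heat_kernel 1 z * (2 powr \<theta> * poly_weight \<theta> x0 x * (1 + \<bar>sqrt t\<bar> powr \<theta>) * (1 + norm z powr \<theta>))"
      by (intro mult_left_mono poly_weight_shift_le assms) auto
    then show "heat_kernel 1 z * poly_weight \<theta> x0 (snd (t, x) + sqrt (fst (t, x)) *\<^sub>R z)
      \<le> 2 powr \<theta> * poly_weight \<theta> x0 x * (1 + \<bar>sqrt t\<bar> powr \<theta>) * (heat_kernel 1 z * (1 + norm z powr \<theta>))"
      by (simp add: ac_simps)
  qed (use assms in \<open>auto intro!: integrable_heat_flow integrable_mult_right integrable_heat_kernel_moment\<close>)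
  also have "\<dots> = 2 powr \<theta> * m * (1 + sqrt t powr \<theta>) * poly_weight \<theta> x0 x"
    using t by (simp add: m_def)
  finally show "heat_flow \<theta> x0 (t, x) \<le> 2 powr \<theta> * m * (1 + sqrt t powr \<theta>) * poly_weight \<theta> x0 x" .
qed

lemma integral_heat_kernel:
  assumes "0 < t"
  shows "(\<integral>z. heat_kernel t (z::'a::euclidean_space) \<partial>lborel) = 1"
  using nn_integral_heat_kernel[OF assms, where 'a = 'a]
  by (intro integral_eq_nn_integral[THEN trans]) auto

text \<open>Of the two antipodal points \<open>x \<plusminus> a z\<close>, at least one is as far from \<open>x0\<close> as \<open>x\<close> is.\<close>

lemma poly_weight_le_heat_flow:
  assumes "0 < \<theta>"
  shows "poly_weight \<theta> x0 (snd P) \<le> 2 * heat_flow \<theta> x0 (P :: real \<times> 'a::euclidean_space)"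
proof -
  define x a where "x = snd P" and "a = sqrt (fst P)"
  \<comment> \<open>Symmetry of the Gaussian makes both antipodal integrals equal to the heat flow,
    hence the factor 2.\<close>
  have reflect: "(\<integral>z. heat_kernel 1 z * poly_weight \<theta> x0 (x + a *\<^sub>R z) \<partial>lborel)
      = (\<integral>z. heat_kernel 1 z * poly_weight \<theta> x0 (x + (- a) *\<^sub>R z) \<partial>lborel)"
  proof -
    have "(\<integral>\<^sup>+z. ennreal (heat_kernel 1 z * poly_weight \<theta> x0 (x + a *\<^sub>R z)) \<partial>lborel)
        = (\<integral>\<^sup>+z. ennreal (heat_kernel 1 z * poly_weight \<theta> x0 (x + (- a) *\<^sub>R z)) \<partial>lborel)"
      by (subst nn_integral_lborel_reflect[where a = 0, symmetric]) auto
    then show ?thesis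
      by (simp add: integral_eq_nn_integral)
  qed
  have "poly_weight \<theta> x0 x = (\<integral>(z::'a). heat_kernel 1 z * poly_weight \<theta> x0 x \<partial>lborel)"
    by (simp add: integral_heat_kernel)
  also have "\<dots> \<le> (\<integral>z. heat_kernel 1 z * poly_weight \<theta> x0 (x + a *\<^sub>R z) + heat_kernel 1 z * poly_weight \<theta> x0 (x + (- a) *\<^sub>R z) \<partial>lborel)"
  proof (rule integral_mono)
    show "integrable lborel (\<lambda>z::'a. heat_kernel 1 z * poly_weight \<theta> x0 x)"
      using integrable_heat_flow[OF assms, of x0 x 0] by simp
    show "integrable lborel (\<lambda>z. heat_kernel 1 z * poly_weight \<theta> x0 (x + a *\<^sub>R z) + heat_kernel 1 z * poly_weight \<theta> x0 (x + (- a) *\<^sub>R z))"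
      by (intro Bochner_Integration.integrable_add integrable_heat_flow assms)
    fix z :: 'a
    have "norm (x - x0) \<le> max (norm (x + a *\<^sub>R z - x0)) (norm (x + (- a) *\<^sub>R z - x0))"
    proof -
      have "2 *\<^sub>R (x - x0) = (x + a *\<^sub>R z - x0) + (x + (- a) *\<^sub>R z - x0)"
        by (simp add: algebra_simps scaleR_2)
      then have "2 * norm (x - x0) \<le> norm (x + a *\<^sub>R z - x0) + norm (x + (- a) *\<^sub>R z - x0)"
        using norm_triangle_ineq[of "x + a *\<^sub>R z - x0" "x + (- a) *\<^sub>R z - x0"]
        by (metis norm_scaleR abs_numeral)
      then show ?thesis
        by linarith
    qed
    then have "norm (x - x0) powr \<theta> \<le> max (norm (x + a *\<^sub>R z - x0)) (norm (x + (- a) *\<^sub>R z - x0)) powr \<theta>"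
      using assms by (intro powr_mono2) auto
    also have "\<dots> \<le> norm (x + a *\<^sub>R z - x0) powr \<theta> + norm (x + (- a) *\<^sub>R z - x0) powr \<theta>"
      by (auto simp: max_def)
    finally have "poly_weight \<theta> x0 x \<le> poly_weight \<theta> x0 (x + a *\<^sub>R z) + poly_weight \<theta> x0 (x + (- a) *\<^sub>R z)"
      by (simp add: poly_weight_def)
    from mult_left_mono[OF this heat_kernel_nonneg[of 1 z]]
    show "heat_kernel 1 z * poly_weight \<theta> x0 x
      \<le> heat_kernel 1 z * poly_weight \<theta> x0 (x + a *\<^sub>R z) + heat_kernel 1 z * poly_weight \<theta> x0 (x + (- a) *\<^sub>R z)"
      by (simp add: distrib_left)
  qed
  also have "\<dots> = 2 * heat_flow \<theta> x0 P"
    using assms by (subst Bochner_Integration.integral_add)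
      (auto intro!: integrable_heat_flow simp: reflect[symmetric] heat_flow_def simp flip: x_def a_def
        simp del: scaleR_minus_left)
  finally show ?thesis
    by (simp add: x_def)
qed

text \<open>Along a convergent sequence the coefficients in \<open>poly_weight_shift_le\<close> stay
  bounded, which gives a dominating function. Negative times are included because
  \<open>sqrt\<close> is continuous on the whole real line.\<close>

lemma continuous_on_heat_flow:
  assumes "0 < \<theta>"
  shows "continuous_on UNIV (heat_flow \<theta> (x0 :: 'a::euclidean_space))"
  unfolding continuous_on_sequentially
proof (intro allI ballI impI, elim conjE)
  fix X :: "nat \<Rightarrow> real \<times> 'a" and P
  assume X: "X \<longlonglongrightarrow> P"
  define b where "b n = 2 powr \<theta> * poly_weight \<theta> x0 (snd (X n)) * (1 + \<bar>sqrt (fst (X n))\<bar> powr \<theta>)" for n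
  have "b \<longlonglongrightarrow> 2 powr \<theta> * poly_weight \<theta> x0 (snd P) * (1 + \<bar>sqrt (fst P)\<bar> powr \<theta>)"
    unfolding b_def[abs_def] poly_weight_def using assms X
    by (intro tendsto_intros tendsto_powr') auto
  then have "Bseq b"
    by (intro convergent_imp_Bseq convergentI)
  then obtain B where B: "\<And>n. \<bar>b n\<bar> \<le> B"
    by (auto simp: Bseq_def)
  have "(\<lambda>n. heat_flow \<theta> x0 (X n)) \<longlonglongrightarrow> heat_flow \<theta> x0 P"
    unfolding heat_flow_def
  proof (rule integral_dominated_convergence[where w = "\<lambda>z. B * (heat_kernel 1 z * (1 + norm z powr \<theta>))"])
    show "integrable lborel (\<lambda>z::'a. B * (heat_kernel 1 z * (1 + norm z powr \<theta>)))"
      by (intro integrable_mult_right integrable_heat_kernel_moment assms)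
    show "AE z in lborel. (\<lambda>n. heat_kernel 1 z * poly_weight \<theta> x0 (snd (X n) + sqrt (fst (X n)) *\<^sub>R z))
        \<longlonglongrightarrow> heat_kernel 1 z * poly_weight \<theta> x0 (snd P + sqrt (fst P) *\<^sub>R z)"
      unfolding poly_weight_def using assms X
      by (intro always_eventually allI tendsto_intros tendsto_powr') auto
    show "AE z in lborel. norm (heat_kernel 1 z * poly_weight \<theta> x0 (snd (X n) + sqrt (fst (X n)) *\<^sub>R z))
        \<le> B * (heat_kernel 1 z * (1 + norm z powr \<theta>))" for n
    proof (intro always_eventually allI)
      fix z :: 'a
      have "poly_weight \<theta> x0 (snd (X n) + sqrt (fst (X n)) *\<^sub>R z) \<le> b n * (1 + norm z powr \<theta>)"
        unfolding b_def by (rule poly_weight_shift_le[OF assms])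
      also have "\<dots> \<le> B * (1 + norm z powr \<theta>)"
        using B[of n] by (intro mult_right_mono) auto
      finally have "heat_kernel 1 z * poly_weight \<theta> x0 (snd (X n) + sqrt (fst (X n)) *\<^sub>R z)
          \<le> heat_kernel 1 z * (B * (1 + norm z powr \<theta>))"
        by (intro mult_left_mono) auto
      then show "norm (heat_kernel 1 z * poly_weight \<theta> x0 (snd (X n) + sqrt (fst (X n)) *\<^sub>R z))
        \<le> B * (heat_kernel 1 z * (1 + norm z powr \<theta>))"
        by (simp add: abs_mult ac_simps)
    qed
  qed measurable
  then show "(heat_flow \<theta> x0 \<circ> X) \<longlonglongrightarrow> heat_flow \<theta> x0 P"
    by (simp add: o_def)
qed

section \<open>Semigroup law and potentials of the heat flow\<close>

text \<open>Brownian scaling: the power of \<open>sqrt t\<close> is the Jacobian of the substitution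
  \<open>y = x + sqrt t *\<^sub>R z\<close>.\<close>

lemma heat_kernel_scale:
  fixes z :: "'a::euclidean_space"
  assumes "0 < t"
  shows "sqrt t ^ DIM('a) * heat_kernel t (sqrt t *\<^sub>R z) = heat_kernel 1 z"
proof -
  define d where "d = real DIM('a) / 2"
  have "sqrt t ^ DIM('a) = t powr d"
    using assms by (simp add: d_def powr_half_sqrt[symmetric] powr_power)
  moreover have "t powr d * (2 * pi * t) powr (- d) = (2 * pi * 1) powr (- d)"
    using assms by (simp add: powr_mult powr_minus field_simps)
  moreover have "- (norm (sqrt t *\<^sub>R z) ^ 2) / (2 * t) = - (norm z ^ 2) / (2 * 1)"
    using assms by (simp add: power_mult_distrib)
  ultimately show ?thesis
    unfolding heat_kernel_def minus_divide_left[symmetric] d_def[symmetric]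
    by (simp add: mult.assoc[symmetric])
qed

lemma heat_flow_eq_nn_integral:
  fixes x :: "'a::euclidean_space"
  assumes "0 < \<theta>" "0 < t"
  shows "ennreal (heat_flow \<theta> x0 (t, x)) = (\<integral>\<^sup>+y. ennreal (heat_kernel t (x - y)) * ennreal (poly_weight \<theta> x0 y) \<partial>lborel)"
proof -
  have "(\<integral>\<^sup>+y. ennreal (heat_kernel t (x - y)) * ennreal (poly_weight \<theta> x0 y) \<partial>lborel)
    = ennreal (\<bar>sqrt t\<bar> ^ DIM('a)) * (\<integral>\<^sup>+z. ennreal (heat_kernel t (x - (x + sqrt t *\<^sub>R z))) * ennreal (poly_weight \<theta> x0 (x + sqrt t *\<^sub>R z)) \<partial>lborel)"
    using assms by (intro nn_integral_lborel_affine) auto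
  also have "\<dots> = (\<integral>\<^sup>+z. ennreal (sqrt t ^ DIM('a)) * (ennreal (heat_kernel t (sqrt t *\<^sub>R z)) * ennreal (poly_weight \<theta> x0 (x + sqrt t *\<^sub>R z))) \<partial>lborel)"
    using assms by (subst nn_integral_cmult) auto
  also have "\<dots> = (\<integral>\<^sup>+z. ennreal (heat_kernel 1 z * poly_weight \<theta> x0 (x + sqrt t *\<^sub>R z)) \<partial>lborel)"
    using assms by (simp add: heat_kernel_scale[OF assms(2), symmetric] ennreal_mult' mult.assoc)
  also have "\<dots> = ennreal (heat_flow \<theta> x0 (t, x))"
    unfolding heat_flow_def by (subst nn_integral_eq_integral) (auto intro!: integrable_heat_flow assms)
  finally show ?thesis
    by simp
qed

text \<open>After Tonelli, Chapman-Kolmogorov merges the two heat kernels.\<close>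

lemma heat_flow_semigroup:
  fixes x :: "'a::euclidean_space"
  assumes "0 < \<theta>" "0 < a" "0 < t"
  shows "(\<integral>\<^sup>+y. ennreal (heat_kernel a (x - y)) * ennreal (heat_flow \<theta> x0 (t, y)) \<partial>lborel) = ennreal (heat_flow \<theta> x0 (a + t, x))"
proof -
  have "(\<integral>\<^sup>+y. ennreal (heat_kernel a (x - y)) * ennreal (heat_flow \<theta> x0 (t, y)) \<partial>lborel)
    = (\<integral>\<^sup>+y. \<integral>\<^sup>+w. ennreal (heat_kernel a (x - y)) * ennreal (heat_kernel t (y - w)) * ennreal (poly_weight \<theta> x0 w) \<partial>lborel \<partial>lborel)"
    using assms by (simp add: heat_flow_eq_nn_integral mult.assoc nn_integral_cmult)
  also have "\<dots> = (\<integral>\<^sup>+w. \<integral>\<^sup>+y. ennreal (heat_kernel a (x - y)) * ennreal (heat_kernel t (y - w)) * ennreal (poly_weight \<theta> x0 w) \<partial>lborel \<partial>lborel)"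
    by (rule lborel_pair.Fubini') measurable
  also have "\<dots> = (\<integral>\<^sup>+w. ennreal (heat_kernel (a + t) (x - w)) * ennreal (poly_weight \<theta> x0 w) \<partial>lborel)"
  proof (rule nn_integral_cong)
    fix w :: 'a
    have "(\<integral>\<^sup>+y. ennreal (heat_kernel a (x - y)) * ennreal (heat_kernel t (y - w)) \<partial>lborel)
      = (\<integral>\<^sup>+y. ennreal (heat_kernel a (x - w - y)) * ennreal (heat_kernel t y) \<partial>lborel)"
      by (subst nn_integral_lborel_translate[where a = w, symmetric]) (auto simp: algebra_simps)
    also have "\<dots> = ennreal (heat_kernel (a + t) (x - w))"
      using assms by (intro Chapman_Kolmogorov)
    finally show "(\<integral>\<^sup>+y. ennreal (heat_kernel a (x - y)) * ennreal (heat_kernel t (y - w)) * ennreal (poly_weight \<theta> x0 w) \<partial>lborel)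
      = ennreal (heat_kernel (a + t) (x - w)) * ennreal (poly_weight \<theta> x0 w)"
      by (simp add: nn_integral_multc)
  qed
  also have "\<dots> = ennreal (heat_flow \<theta> x0 (a + t, x))"
    using assms by (simp add: heat_flow_eq_nn_integral)
  finally show ?thesis .
qed

lemma borel_measurable_heat_flow [measurable (raw)]:
  assumes "0 < \<theta>" and f: "f \<in> borel_measurable M"
  shows "(\<lambda>w. heat_flow \<theta> x0 (f w)) \<in> borel_measurable M"
  using continuous_on_heat_flow[OF assms(1)] f by (rule borel_measurable_continuous_on)

text \<open>The source of the factor 2 in the barrier: with it, the barrier dominates the difference
  of the data at all nonnegative times.\<close>

lemma poly_weight_le_exp_heat_flow:
  fixes P :: "real \<times> 'a::euclidean_space"
  assumes "0 < \<theta>" "0 \<le> M" "0 \<le> \<mu>" "0 \<le> fst P"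
  shows "M * poly_weight \<theta> x0 (snd P) \<le> 2 * M * exp (\<mu> * fst P) * heat_flow \<theta> x0 P"
proof -
  have "M * poly_weight \<theta> x0 (snd P) \<le> M * (2 * heat_flow \<theta> x0 P) * 1"
    using mult_left_mono[OF poly_weight_le_heat_flow[OF assms(1)] assms(2), of x0 P] by simp
  also have "\<dots> \<le> M * (2 * heat_flow \<theta> x0 P) * exp (\<mu> * fst P)"
    using assms by (intro mult_left_mono) auto
  finally show ?thesis
    by (simp add: ac_simps)
qed

text \<open>The heat flow is caloric: from every positive intermediate time the kernel carries it to
  the same value at \<open>P\<close>, so a purely temporal integral remains. The density
  \<open>\<rho>\<close> covers constant and exponential factors.\<close>

lemma potential_heat_flow:
  fixes P :: "real \<times> 'a::euclidean_space" and \<rho> :: "real \<Rightarrow> ennreal"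
  assumes \<theta>: "0 < \<theta>" and [measurable]: "\<rho> \<in> borel_measurable borel"
  shows "potential p (\<lambda>Q. indicator {0..} (fst Q) * \<rho> (fst Q) * ennreal (heat_flow \<theta> x0 Q)) P
    = ennreal (heat_flow \<theta> x0 P)
      * (\<integral>\<^sup>+\<sigma>. ennreal (exp (- p * \<sigma>)) * indicator {0<..<fst P} \<sigma> * \<rho> (fst P - \<sigma>) \<partial>lborel)"
proof -
  note [measurable] = borel_measurable_heat_flow[OF \<theta>]
  obtain t x where P: "P = (t, x)"
    by (cases P)
  have "potential p (\<lambda>Q. indicator {0..} (fst Q) * \<rho> (fst Q) * ennreal (heat_flow \<theta> x0 Q)) P
    = (\<integral>\<^sup>+s. \<integral>\<^sup>+y. ennreal (causal_kernel p (P - (s, y)))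
        * (indicator {0..} s * \<rho> s * ennreal (heat_flow \<theta> x0 (s, y))) \<partial>lborel \<partial>lborel)"
    unfolding potential_def by (subst nn_integral_lborel_pair) auto
  also have "\<dots> = (\<integral>\<^sup>+s. ennreal (heat_flow \<theta> x0 P)
        * (ennreal (exp (- p * (t - s))) * indicator {0<..<t} (t - s) * \<rho> (t - (t - s))) \<partial>lborel)"
  proof (rule nn_integral_cong_AE)
    \<comment> \<open>Time \<open>s = 0\<close> is discarded as a null set, since the semigroup law
      is available only from positive times.\<close>
    have "(\<integral>\<^sup>+y. ennreal (causal_kernel p (P - (s, y))) * (indicator {0..} s * \<rho> s * ennreal (heat_flow \<theta> x0 (s, y))) \<partial>lborel)
      = ennreal (heat_flow \<theta> x0 P) * (ennreal (exp (- p * (t - s))) * indicator {0<..<t} (t - s) * \<rho> (t - (t - s)))"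
      if "s \<noteq> 0" for s
    proof (cases "0 < s \<and> s < t")
      case True
      have "(\<integral>\<^sup>+y. ennreal (causal_kernel p (P - (s, y))) * (indicator {0..} s * \<rho> s * ennreal (heat_flow \<theta> x0 (s, y))) \<partial>lborel)
        = (\<integral>\<^sup>+y. ennreal (exp (- p * (t - s))) * \<rho> s * (ennreal (heat_kernel (t - s) (x - y)) * ennreal (heat_flow \<theta> x0 (s, y))) \<partial>lborel)"
        using True by (simp add: P causal_kernel_def ennreal_mult' ac_simps)
      also have "\<dots> = ennreal (exp (- p * (t - s))) * \<rho> s * ennreal (heat_flow \<theta> x0 (t - s + s, x))"
        using True \<theta> by (simp add: nn_integral_cmult heat_flow_semigroup del: diff_add_cancel)
      finally show ?thesis
        using True by (simp add: P ac_simps)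
    next
      case False
      with that have "ennreal (causal_kernel p (P - (s, y))) * (indicator {0..} s * \<rho> s * ennreal (heat_flow \<theta> x0 (s, y))) = 0" for y
        by (auto simp: P causal_kernel_def indicator_def)
      then show ?thesis
        using False that by (simp only:) (auto simp: indicator_def)
    qed
    then show "AE s in lborel. (\<integral>\<^sup>+y. ennreal (causal_kernel p (P - (s, y))) * (indicator {0..} s * \<rho> s * ennreal (heat_flow \<theta> x0 (s, y))) \<partial>lborel)
      = ennreal (heat_flow \<theta> x0 P) * (ennreal (exp (- p * (t - s))) * indicator {0<..<t} (t - s) * \<rho> (t - (t - s)))"
      using AE_lborel_singleton[of 0] by (auto elim: eventually_mono)
  qed
  also have "\<dots> = (\<integral>\<^sup>+\<sigma>. ennreal (heat_flow \<theta> x0 P)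
        * (ennreal (exp (- p * \<sigma>)) * indicator {0<..<t} \<sigma> * \<rho> (t - \<sigma>)) \<partial>lborel)"
    by (rule nn_integral_lborel_reflect[where f = "\<lambda>\<sigma>. ennreal (heat_flow \<theta> x0 P)
        * (ennreal (exp (- p * \<sigma>)) * indicator {0<..<t} \<sigma> * \<rho> (t - \<sigma>))"]) measurable
  also have "\<dots> = ennreal (heat_flow \<theta> x0 P)
        * (\<integral>\<^sup>+\<sigma>. ennreal (exp (- p * \<sigma>)) * indicator {0<..<t} \<sigma> * \<rho> (t - \<sigma>) \<partial>lborel)"
    by (rule nn_integral_cmult) measurable
  finally show ?thesis
    by (simp add: P)
qed

text \<open>Up to truncation at zero, the left side is the flow times
  \<open>1 - exp (- p * t)\<close>, a factor of at most 1. This supplies the excessive term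
  \<open>e\<close> of \<open>potential_domination\<close>.\<close>

lemma heat_flow_excessive:
  fixes P :: "real \<times> 'a::euclidean_space"
  assumes \<theta>: "0 < \<theta>" and A: "0 \<le> A"
  shows "ennreal p * potential p (\<lambda>Q. ennreal (indicator {0..} (fst Q) * (A * heat_flow \<theta> x0 Q))) P
    \<le> ennreal (indicator {0..} (fst P) * (A * heat_flow \<theta> x0 P))"
proof -
  have eq: "ennreal (indicator {0..} (fst Q) * (A * heat_flow \<theta> x0 Q))
    = indicator {0..} (fst Q) * ennreal A * ennreal (heat_flow \<theta> x0 Q)" for Q :: "real \<times> 'a"
    using A by (auto simp: indicator_def ennreal_mult')
  have "ennreal p * potential p (\<lambda>Q. ennreal (indicator {0..} (fst Q) * (A * heat_flow \<theta> x0 Q))) P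
    = ennreal (heat_flow \<theta> x0 P) * ennreal A
      * (ennreal p * (\<integral>\<^sup>+\<sigma>. ennreal (exp (- p * \<sigma>)) * indicator {0<..<fst P} \<sigma> \<partial>lborel))"
    unfolding eq potential_heat_flow[OF \<theta> borel_measurable_const]
    by (subst nn_integral_multc) (auto simp: ac_simps)
  also have "\<dots> \<le> indicator {0..} (fst P) * ennreal A * ennreal (heat_flow \<theta> x0 P)"
  proof (cases "0 \<le> fst P")
    case True
    then have "ennreal (heat_flow \<theta> x0 P) * ennreal A
        * (ennreal p * (\<integral>\<^sup>+\<sigma>. ennreal (exp (- p * \<sigma>)) * indicator {0<..<fst P} \<sigma> \<partial>lborel))
      \<le> ennreal (heat_flow \<theta> x0 P) * ennreal A * 1"
      unfolding nn_integral_exp_Ioo[OF True] by (intro mult_left_mono) (auto simp: ennreal_le_1)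
    then show ?thesis
      using True by (simp add: ac_simps)
  qed simp
  finally show ?thesis
    unfolding eq .
qed

text \<open>Factoring \<open>exp (\<mu> * (t - \<sigma>))\<close> makes the time integral explicit.
  With \<open>\<mu> = 2 * \<kappa>\<close> this is the linear integral equation of the
  barrier.\<close>

lemma potential_exp_heat_flow:
  fixes P :: "real \<times> 'a::euclidean_space"
  assumes \<theta>: "0 < \<theta>" and A: "0 \<le> A" and \<mu>: "0 < \<mu>" and P: "0 \<le> fst P"
  shows "potential 0 (\<lambda>Q. ennreal (indicator {0..} (fst Q) * (A * exp (\<mu> * fst Q) * heat_flow \<theta> x0 Q))) P
    = ennreal ((exp (\<mu> * fst P) - 1) / \<mu> * (A * heat_flow \<theta> x0 P))"
proof -
  let ?I = "\<integral>\<^sup>+\<sigma>. ennreal (exp (- \<mu> * \<sigma>)) * indicator {0<..<fst P} \<sigma> \<partial>lborel"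
  have I: "?I = ennreal ((1 - exp (- \<mu> * fst P)) / \<mu>)"
  proof -
    have "?I = ennreal (1 / \<mu>) * (ennreal \<mu> * ?I)"
      using \<mu> by (simp add: mult.assoc[symmetric] ennreal_mult'[symmetric])
    also have "\<dots> = ennreal (1 / \<mu>) * ennreal (1 - exp (- \<mu> * fst P))"
      by (simp only: nn_integral_exp_Ioo[OF P])
    finally show ?thesis
      using \<mu> by (simp add: ennreal_mult'[symmetric])
  qed
  have "ennreal (indicator {0..} (fst Q) * (A * exp (\<mu> * fst Q) * heat_flow \<theta> x0 Q))
    = indicator {0..} (fst Q) * ennreal (A * exp (\<mu> * fst Q)) * ennreal (heat_flow \<theta> x0 Q)" for Q :: "real \<times> 'a"
    using A by (auto simp: indicator_def ennreal_mult')
  then have "potential 0 (\<lambda>Q. ennreal (indicator {0..} (fst Q) * (A * exp (\<mu> * fst Q) * heat_flow \<theta> x0 Q))) P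
    = ennreal (heat_flow \<theta> x0 P)
      * (\<integral>\<^sup>+\<sigma>. ennreal (exp (- 0 * \<sigma>)) * indicator {0<..<fst P} \<sigma> * ennreal (A * exp (\<mu> * (fst P - \<sigma>))) \<partial>lborel)"
    by (simp only:) (rule potential_heat_flow[OF \<theta>, where \<rho> = "\<lambda>s. ennreal (A * exp (\<mu> * s))"], measurable)
  also have "(\<integral>\<^sup>+\<sigma>. ennreal (exp (- 0 * \<sigma>)) * indicator {0<..<fst P} \<sigma> * ennreal (A * exp (\<mu> * (fst P - \<sigma>))) \<partial>lborel)
      = (\<integral>\<^sup>+\<sigma>. ennreal (A * exp (\<mu> * fst P)) * (ennreal (exp (- \<mu> * \<sigma>)) * indicator {0<..<fst P} \<sigma>) \<partial>lborel)"
  proof (rule nn_integral_cong)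
    fix \<sigma>
    have "A * exp (\<mu> * (fst P - \<sigma>)) = A * exp (\<mu> * fst P) * exp (- \<mu> * \<sigma>)"
      by (simp add: algebra_simps flip: exp_add)
    then show "ennreal (exp (- 0 * \<sigma>)) * indicator {0<..<fst P} \<sigma> * ennreal (A * exp (\<mu> * (fst P - \<sigma>)))
      = ennreal (A * exp (\<mu> * fst P)) * (ennreal (exp (- \<mu> * \<sigma>)) * indicator {0<..<fst P} \<sigma>)"
      using A by (simp only: ennreal_mult'[of "A * exp (\<mu> * fst P)"]) (simp add: ac_simps ennreal_mult')
  qed
  also have "\<dots> = ennreal (A * exp (\<mu> * fst P)) * ?I"
    by (rule nn_integral_cmult) measurable
  also have "ennreal (heat_flow \<theta> x0 P) * \<dots> = ennreal (heat_flow \<theta> x0 P * (A * exp (\<mu> * fst P) * ((1 - exp (- \<mu> * fst P)) / \<mu>)))"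
    unfolding I using A by (simp flip: ennreal_mult')
  also have "heat_flow \<theta> x0 P * (A * exp (\<mu> * fst P) * ((1 - exp (- \<mu> * fst P)) / \<mu>))
    = (exp (\<mu> * fst P) - 1) / \<mu> * (A * heat_flow \<theta> x0 P)"
    using \<mu> by (simp add: field_simps exp_minus)
  finally show ?thesis .
qed

section \<open>Comparison of mild solutions\<close>

text \<open>Here \<open>\<zeta>\<close> is the difference of the data, \<open>v\<close> that of the
  solutions minus \<open>\<zeta>\<close>, and \<open>g\<close> that of the reaction terms. Only an
  upper bound is claimed, as the hypothesis is one-sided; exchanging the solutions gives the lower
  one.\<close>

lemma mild_comparison:
  fixes v g \<zeta> :: "real \<times> 'a::euclidean_space \<Rightarrow> real" and T :: real
  defines "S \<equiv> {0..T} \<times> UNIV"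
  assumes \<theta>: "0 < \<theta>" and \<kappa>: "0 < \<kappa>" and M: "0 \<le> M"
    and v: "continuous_on S v" and g: "continuous_on S g"
    and int: "\<And>P. P \<in> S \<Longrightarrow> integrable lborel (\<lambda>Q. causal_kernel 0 (P - Q) * (indicator S Q * g Q))"
    and v_eq: "\<And>P. P \<in> S \<Longrightarrow> v P = (\<integral>Q. causal_kernel 0 (P - Q) * (indicator S Q * g Q) \<partial>lborel)"
    and \<zeta>: "\<And>P. P \<in> S \<Longrightarrow> \<bar>\<zeta> P\<bar> \<le> M * poly_weight \<theta> x0 (snd P)"
    and one_sided: "\<And>P. P \<in> S \<Longrightarrow> 0 \<le> v P + \<zeta> P \<Longrightarrow> g P \<le> \<kappa> * (v P + \<zeta> P)"
    and P: "P \<in> S"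
  shows "v P \<le> 2 * M * exp (2 * \<kappa> * fst P) * heat_flow \<theta> x0 P"
proof -
  have "closed S"
    unfolding S_def by (intro closed_Times) auto
  then have [measurable]: "S \<in> sets borel"
    by simp
  note [measurable] = borel_measurable_heat_flow[OF \<theta>]
  define \<Phi> where "\<Phi> Q = 2 * M * exp (2 * \<kappa> * fst Q) * heat_flow \<theta> x0 Q" for Q
  \<comment> \<open>Cutting off to \<open>S\<close> gives Borel functions on all of space-time,
    although \<open>v\<close> and \<open>g\<close> are controlled only on \<open>S\<close>.\<close>
  define \<phi> where "\<phi> Q = indicator S Q * \<Phi> Q" for Q
  define h where "h Q = indicator S Q * max 0 (v Q - \<Phi> Q)" for Q
  define G where "G Q = indicator S Q * g Q" for Q
  define r where "r Q = G Q - 2 * \<kappa> * \<phi> Q - \<kappa> * h Q" for Q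
  have \<Phi>_cont: "continuous_on S \<Phi>"
    unfolding \<Phi>_def[abs_def]
    by (intro continuous_intros continuous_on_subset[OF continuous_on_heat_flow[OF \<theta>]]) auto
  have [measurable]: "\<phi> \<in> borel_measurable borel" "h \<in> borel_measurable borel" "G \<in> borel_measurable borel"
    unfolding \<phi>_def[abs_def] h_def[abs_def] G_def[abs_def]
    using v g \<Phi>_cont
    by (auto intro!: borel_measurable_continuous_on_indicator[where 'b = real, simplified] continuous_intros)
  then have [measurable]: "r \<in> borel_measurable borel"
    unfolding r_def[abs_def] by measurable
  have \<phi>_nn: "0 \<le> \<phi> Q" and h_nn: "0 \<le> h Q" for Q
    using M by (auto simp: \<phi>_def \<Phi>_def h_def)
  have S_T: "fst Q < 0" if "fst Q \<le> T" "Q \<notin> S" for Q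
    using that by (auto simp: S_def mem_Times_iff)
  have ennreal_integral: "integrable lborel (\<lambda>R. causal_kernel 0 (Q - R) * k R)
      \<and> ennreal (\<integral>R. causal_kernel 0 (Q - R) * k R \<partial>lborel) = potential 0 (\<lambda>R. ennreal (k R)) Q"
    if [measurable]: "k \<in> borel_measurable borel" and "\<And>R. 0 \<le> k R" "potential 0 (\<lambda>R. ennreal (k R)) Q < \<infinity>" for k Q
  proof -
    have eq: "(\<integral>\<^sup>+R. ennreal (causal_kernel 0 (Q - R) * k R) \<partial>lborel) = potential 0 (\<lambda>R. ennreal (k R)) Q"
      by (simp add: potential_def ennreal_mult')
    have "integrable lborel (\<lambda>R. causal_kernel 0 (Q - R) * k R)"
      using that by (intro integrableI_nonneg) (auto simp: eq)
    then show ?thesis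
      using that by (simp add: nn_integral_eq_integral[symmetric] eq)
  qed
  have G_fin: "potential 0 (\<lambda>R. ennreal \<bar>G R\<bar>) Q < \<infinity>" if "Q \<in> S" for Q
  proof -
    have "integrable lborel (\<lambda>R. causal_kernel 0 (Q - R) * G R)"
      using int[OF that] by (simp add: G_def)
    then show ?thesis
      by (simp add: integrable_iff_bounded potential_def abs_mult ennreal_mult')
  qed
  \<comment> \<open>Since \<open>h \<le> \<bar>v\<bar>\<close> and \<open>\<bar>v\<bar>\<close> is
    at most the potential of \<open>\<bar>G\<bar>\<close>, the potential of \<open>h\<close> is
    bounded by an iterated one. No growth bound on the solutions enters.\<close>
  have h_fin: "potential 0 (\<lambda>R. ennreal (h R)) Q < \<infinity>" if Q: "Q \<in> S" for Q
  proof -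
    have "potential 0 (\<lambda>R. ennreal (h R)) Q \<le> potential 0 (potential 0 (\<lambda>R. ennreal \<bar>G R\<bar>)) Q"
    proof (rule potential_mono)
      fix R
      show "ennreal (h R) \<le> potential 0 (\<lambda>R. ennreal \<bar>G R\<bar>) R"
      proof (cases "R \<in> S")
        case True
        have "0 \<le> \<Phi> R"
          using M by (simp add: \<Phi>_def)
        then have "ennreal (h R) \<le> ennreal \<bar>v R\<bar>"
          using True by (intro ennreal_leI) (auto simp: h_def)
        also have "\<dots> \<le> potential 0 (\<lambda>R. ennreal \<bar>G R\<bar>) R"
          using integral_norm_bound_ennreal[OF int[OF True]] True
          by (simp add: v_eq[OF True] potential_def abs_mult ennreal_mult' G_def)
        finally show ?thesis .
      qed (simp add: h_def)
    qed
    also have "\<dots> \<le> ennreal (fst Q) * potential 0 (\<lambda>R. ennreal \<bar>G R\<bar>) Q"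
      by (rule potential_potential_le) (measurable, auto simp: G_def S_def mem_Times_iff)
    also have "\<dots> < \<infinity>"
      using G_fin[OF Q] by (simp add: ennreal_mult_less_top)
    finally show ?thesis .
  qed
  have \<phi>_pot: "potential 0 (\<lambda>R. ennreal (\<phi> R)) Q = ennreal ((exp (2 * \<kappa> * fst Q) - 1) / (2 * \<kappa>) * (2 * M * heat_flow \<theta> x0 Q))"
    if Q: "Q \<in> S" for Q
  proof -
    have "potential 0 (\<lambda>R. ennreal (\<phi> R)) Q
        = potential 0 (\<lambda>R. ennreal (indicator {0..} (fst R) * (2 * M * exp (2 * \<kappa> * fst R) * heat_flow \<theta> x0 R))) Q"
      using Q by (intro potential_cong) (auto simp: \<phi>_def \<Phi>_def S_def mem_Times_iff indicator_def)
    also have "\<dots> = ennreal ((exp (2 * \<kappa> * fst Q) - 1) / (2 * \<kappa>) * (2 * M * heat_flow \<theta> x0 Q))"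
      using \<theta> M \<kappa> Q by (intro potential_exp_heat_flow) (auto simp: S_def mem_Times_iff)
    finally show ?thesis .
  qed
  \<comment> \<open>The equation of the barrier: \<open>\<Phi>\<close> is its free flow plus
    \<open>2 * \<kappa>\<close> times its own potential.\<close>
  have \<phi>_int: "2 * \<kappa> * (\<integral>R. causal_kernel 0 (Q - R) * \<phi> R \<partial>lborel) = \<Phi> Q - 2 * M * heat_flow \<theta> x0 Q"
    and \<phi>_integrable: "integrable lborel (\<lambda>R. causal_kernel 0 (Q - R) * \<phi> R)" if Q: "Q \<in> S" for Q
  proof -
    have *: "integrable lborel (\<lambda>R. causal_kernel 0 (Q - R) * \<phi> R)"
      "ennreal (\<integral>R. causal_kernel 0 (Q - R) * \<phi> R \<partial>lborel) = potential 0 (\<lambda>R. ennreal (\<phi> R)) Q"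
      using ennreal_integral[of \<phi> Q] \<phi>_nn by (auto simp: \<phi>_pot[OF Q])
    show "integrable lborel (\<lambda>R. causal_kernel 0 (Q - R) * \<phi> R)"
      by fact
    have "0 \<le> (\<integral>R. causal_kernel 0 (Q - R) * \<phi> R \<partial>lborel)"
      using \<phi>_nn by (intro Bochner_Integration.integral_nonneg) simp
    moreover have "0 \<le> (exp (2 * \<kappa> * fst Q) - 1) / (2 * \<kappa>) * (2 * M * heat_flow \<theta> x0 Q)"
      using M \<kappa> Q by (intro mult_nonneg_nonneg divide_nonneg_nonneg) (auto simp: S_def mem_Times_iff)
    ultimately have "(\<integral>R. causal_kernel 0 (Q - R) * \<phi> R \<partial>lborel)
        = (exp (2 * \<kappa> * fst Q) - 1) / (2 * \<kappa>) * (2 * M * heat_flow \<theta> x0 Q)"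
      using *(2) unfolding \<phi>_pot[OF Q] by (subst (asm) ennreal_inj) auto
    then show "2 * \<kappa> * (\<integral>R. causal_kernel 0 (Q - R) * \<phi> R \<partial>lborel) = \<Phi> Q - 2 * M * heat_flow \<theta> x0 Q"
      using \<kappa> by (simp add: \<Phi>_def field_simps)
  qed
  have h_integrable: "integrable lborel (\<lambda>R. causal_kernel 0 (Q - R) * h R)"
    and h_int: "ennreal (\<integral>R. causal_kernel 0 (Q - R) * h R \<partial>lborel) = potential 0 (\<lambda>R. ennreal (h R)) Q" if Q: "Q \<in> S" for Q
    using ennreal_integral[of h Q] h_nn h_fin[OF Q] by auto
  \<comment> \<open>\<open>ennreal\<close> truncates negative numbers, so these are the potentials
    of the positive and the negative part of \<open>r\<close>.\<close>
  let ?V = "\<lambda>Q. potential 0 (\<lambda>R. ennreal (r R)) Q"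
  let ?W = "\<lambda>Q. potential 0 (\<lambda>R. ennreal (- r R)) Q"
  \<comment> \<open>The signed potential of \<open>r\<close> is \<open>v - \<Phi>\<close> plus
    \<open>2 * M * heat_flow \<theta> x0\<close>, minus \<open>\<kappa>\<close> times the potential
    of \<open>h\<close>; in the equivalence the flow cancels.\<close>
  have r_fin: "?V Q < \<infinity>"
    and r_iff: "?V Q \<le> ?W Q + ennreal (2 * M * heat_flow \<theta> x0 Q)
      \<longleftrightarrow> v Q - \<Phi> Q \<le> \<kappa> * (\<integral>R. causal_kernel 0 (Q - R) * h R \<partial>lborel)" if Q: "Q \<in> S" for Q
  proof -
    have split: "causal_kernel 0 (Q - R) * r R = causal_kernel 0 (Q - R) * G R
        - 2 * \<kappa> * (causal_kernel 0 (Q - R) * \<phi> R) - \<kappa> * (causal_kernel 0 (Q - R) * h R)" for R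
      by (simp add: r_def algebra_simps)
    have G_int: "integrable lborel (\<lambda>R. causal_kernel 0 (Q - R) * G R)"
      using int[OF Q] by (simp add: G_def)
    have r_int: "integrable lborel (\<lambda>R. causal_kernel 0 (Q - R) * r R)"
      unfolding split
      by (intro Bochner_Integration.integrable_diff integrable_mult_right G_int \<phi>_integrable h_integrable Q)
    have "(\<integral>R. causal_kernel 0 (Q - R) * r R \<partial>lborel)
      = v Q - 2 * \<kappa> * (\<integral>R. causal_kernel 0 (Q - R) * \<phi> R \<partial>lborel) - \<kappa> * (\<integral>R. causal_kernel 0 (Q - R) * h R \<partial>lborel)"
      unfolding split
      by (simp add: G_int \<phi>_integrable[OF Q] h_integrable[OF Q] v_eq[OF Q] flip: G_def)
    then have r_eq: "(\<integral>R. causal_kernel 0 (Q - R) * r R \<partial>lborel)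
      = v Q - (\<Phi> Q - 2 * M * heat_flow \<theta> x0 Q) - \<kappa> * (\<integral>R. causal_kernel 0 (Q - R) * h R \<partial>lborel)"
      by (simp only: \<phi>_int[OF Q])
    have V: "?V Q = (\<integral>\<^sup>+R. ennreal (causal_kernel 0 (Q - R) * r R) \<partial>lborel)"
      "?W Q = (\<integral>\<^sup>+R. ennreal (- (causal_kernel 0 (Q - R) * r R)) \<partial>lborel)"
      by (simp_all only: potential_def ennreal_mult'[OF causal_kernel_nonneg] minus_mult_right)
    have fin: "?V Q \<noteq> \<infinity>" "?W Q \<noteq> \<infinity>"
      using r_int unfolding V real_integrable_def by auto
    then show "?V Q < \<infinity>"
      by (simp add: less_top)
    have e: "0 \<le> 2 * M * heat_flow \<theta> x0 Q"
      using M by simp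
    have "?V Q \<le> ?W Q + ennreal (2 * M * heat_flow \<theta> x0 Q)
        \<longleftrightarrow> enn2real (?V Q) \<le> enn2real (?W Q) + 2 * M * heat_flow \<theta> x0 Q"
    proof (cases "?V Q" rule: ennreal_cases)
      case (real a)
      note V = this
      show ?thesis
      proof (cases "?W Q" rule: ennreal_cases)
        case (real b)
        with V e show ?thesis
          by (simp add: ennreal_plus[symmetric] del: ennreal_plus)
      qed (use fin in auto)
    qed (use fin in auto)
    also have "\<dots> \<longleftrightarrow> (\<integral>R. causal_kernel 0 (Q - R) * r R \<partial>lborel) \<le> 2 * M * heat_flow \<theta> x0 Q"
      unfolding real_lebesgue_integral_def[OF r_int] V by auto
    finally show "?V Q \<le> ?W Q + ennreal (2 * M * heat_flow \<theta> x0 Q)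
      \<longleftrightarrow> v Q - \<Phi> Q \<le> \<kappa> * (\<integral>R. causal_kernel 0 (Q - R) * h R \<partial>lborel)"
      unfolding r_eq by auto
  qed
  have pos_part: "0 \<le> \<kappa> * (\<integral>R. causal_kernel 0 (Q - R) * h R \<partial>lborel)" for Q
    using \<kappa> h_nn by (intro mult_nonneg_nonneg Bochner_Integration.integral_nonneg) auto
  let ?e = "\<lambda>Q. ennreal (indicator {0..} (fst Q) * (2 * M * heat_flow \<theta> x0 Q))"
  have dominated: "?V Q \<le> ?W Q + ?e Q" if "fst Q \<le> T" for Q
  proof (rule potential_domination[OF _ _ _ _ _ _ _ that])
    show "ennreal (r R) = 0" if "fst R < 0" for R
      using that by (simp add: r_def G_def \<phi>_def h_def S_def mem_Times_iff)
    then have V0: "?V R = 0" if "fst R < 0" for R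
    proof -
      have "?V R = potential 0 (\<lambda>_. 0) R"
        using that \<open>\<And>R. fst R < 0 \<Longrightarrow> ennreal (r R) = 0\<close> by (intro potential_cong) auto
      then show ?thesis
        by (simp add: potential_def)
    qed
    show "?V R < \<infinity>" if "fst R \<le> T" for R
      using r_fin[of R] V0[of R] S_T[of R] that by (cases "R \<in> S") auto
    show "ennreal (real n) * potential (real n) ?e R \<le> ?e R" for n R
      using M by (intro heat_flow_excessive \<theta>) auto
    fix R
    assume R: "ennreal (r R) \<noteq> 0" "fst R < T"
    then have rR: "0 < r R"
      by (simp add: ennreal_eq_0_iff not_le)
    then have RS: "R \<in> S"
      by (cases "R \<in> S") (auto simp: r_def G_def \<phi>_def h_def)
    \<comment> \<open>If \<open>v \<ge> \<Phi> \<ge> \<bar>\<zeta>\<bar>\<close> at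
      \<open>R\<close>, then \<open>v + \<zeta> \<ge> 0\<close> and the one-sided bound gives
      \<open>g \<le> \<kappa> * (v - \<Phi>) + 2 * \<kappa> * \<Phi>\<close>, that is
      \<open>r \<le> 0\<close>.\<close>
    have "v R < \<Phi> R"
    proof (rule ccontr)
      assume ge: "\<not> v R < \<Phi> R"
      have "\<bar>\<zeta> R\<bar> \<le> M * poly_weight \<theta> x0 (snd R)"
        by (rule \<zeta>[OF RS])
      also have "\<dots> \<le> \<Phi> R"
        unfolding \<Phi>_def using \<theta> M \<kappa> RS
        by (intro poly_weight_le_exp_heat_flow) (auto simp: S_def mem_Times_iff)
      finally have \<zeta>R: "\<bar>\<zeta> R\<bar> \<le> \<Phi> R" .
      then have "g R \<le> \<kappa> * (v R + \<zeta> R)"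
        using ge by (intro one_sided RS) auto
      also have "\<dots> \<le> \<kappa> * ((v R - \<Phi> R) + 2 * \<Phi> R)"
        using \<zeta>R \<kappa> by (intro mult_left_mono) auto
      finally have "r R \<le> 0"
        using ge RS by (simp add: r_def G_def \<phi>_def h_def algebra_simps max_def)
      with rR show False
        by simp
    qed
    \<comment> \<open>By continuity \<open>v\<close> stays below \<open>\<Phi>\<close> near
      \<open>R\<close> in \<open>S\<close>; there the right side of \<open>r_iff\<close> compares a
      negative number with a nonnegative one.\<close>
    moreover have "continuous_on S (\<lambda>Q. v Q - \<Phi> Q)"
      by (intro continuous_intros v \<Phi>_cont)
    ultimately obtain \<delta> where \<delta>: "0 < \<delta>" "\<And>Q. Q \<in> S \<Longrightarrow> dist Q R < \<delta> \<Longrightarrow> dist (v Q - \<Phi> Q) (v R - \<Phi> R) < \<Phi> R - v R"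
      using RS unfolding continuous_on_iff by (metis diff_gt_0_iff_gt)
    show "\<exists>\<delta>>0. \<forall>Q. fst R < fst Q \<longrightarrow> fst Q \<le> T \<longrightarrow> dist Q R < \<delta> \<longrightarrow> ?V Q \<le> ?W Q + ?e Q"
    proof (intro exI[of _ \<delta>] conjI allI impI \<delta>(1))
      fix Q :: "real \<times> 'a"
      assume Q: "fst R < fst Q" "fst Q \<le> T" "dist Q R < \<delta>"
      then have QS: "Q \<in> S"
        using RS by (auto simp: S_def mem_Times_iff)
      have "v Q - \<Phi> Q \<le> 0"
        using \<delta>(2)[OF QS Q(3)] by (auto simp: dist_real_def)
      then have "v Q - \<Phi> Q \<le> \<kappa> * (\<integral>R. causal_kernel 0 (Q - R) * h R \<partial>lborel)"
        using pos_part[of Q] by linarith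
      then show "?V Q \<le> ?W Q + ?e Q"
        using r_iff[OF QS] QS by (simp add: S_def mem_Times_iff)
    qed
  qed measurable
  \<comment> \<open>Read through \<open>r_iff\<close>, domination up to time \<open>T\<close> says
    that \<open>h\<close> is at most \<open>\<kappa>\<close> times its own potential.\<close>
  have "ennreal (h P) = 0"
  proof (rule potential_Gronwall[where h = "\<lambda>Q. ennreal (h Q)" and p = \<kappa> and T = T])
    show "potential 0 (\<lambda>Q. ennreal (h Q)) P < \<infinity>" "fst P \<le> T"
      using h_fin[OF P] P by (auto simp: S_def mem_Times_iff)
    show "ennreal (h Q) \<le> ennreal \<kappa> * potential 0 (\<lambda>Q. ennreal (h Q)) Q" if "fst Q \<le> T" for Q
    proof (cases "Q \<in> S")
      case True
      have "v Q - \<Phi> Q \<le> \<kappa> * (\<integral>R. causal_kernel 0 (Q - R) * h R \<partial>lborel)"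
        using dominated[OF that] r_iff[OF True] True by (simp add: S_def mem_Times_iff)
      then have "h Q \<le> \<kappa> * (\<integral>R. causal_kernel 0 (Q - R) * h R \<partial>lborel)"
        using True pos_part[of Q] by (simp add: h_def)
      then have "ennreal (h Q) \<le> ennreal (\<kappa> * (\<integral>R. causal_kernel 0 (Q - R) * h R \<partial>lborel))"
        by (rule ennreal_leI)
      then show ?thesis
        using \<kappa> by (simp add: ennreal_mult' h_int[OF True])
    qed (simp add: h_def)
  qed (measurable, use \<kappa> in \<open>auto simp: h_def S_def mem_Times_iff\<close>)
  then show ?thesis
    using P h_nn[of P] by (simp add: h_def \<Phi>_def ennreal_eq_0_iff)
qed

text \<open>Truncating the kernel to positive times loses nothing at \<open>s = t\<close>, since \<open>0 powr a = 0\<close> makes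
  \<^term>\<open>heat_kernel 0\<close> vanish.\<close>

lemma is_solution_causal_kernel:
  fixes u z :: "real \<Rightarrow> 'a::euclidean_space \<Rightarrow> real"
  defines "S T \<equiv> {0..T} \<times> UNIV"
  assumes "is_solution f T z u" and P: "P \<in> S T"
  shows "integrable lborel (\<lambda>Q. causal_kernel 0 (P - Q) * (indicator (S T) Q * f (u (fst Q) (snd Q))))"
    and "u (fst P) (snd P)
      = (\<integral>Q. causal_kernel 0 (P - Q) * (indicator (S T) Q * f (u (fst Q) (snd Q))) \<partial>lborel) + z (fst P) (snd P)"
proof -
  obtain t x where tx: "P = (t, x)" "t \<in> {0..T}"
    using P by (auto simp: S_def)
  \<comment> \<open>Enlarging the domain from time \<open>t\<close> to \<open>T\<close> is harmless
    because the causal kernel vanishes for \<open>s \<ge> t\<close>.\<close>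
  have eq: "indicator ({0..t} \<times> UNIV) Q *\<^sub>R (case Q of (s, y) \<Rightarrow> heat_kernel (t - s) (x - y) * f (u s y))
      = causal_kernel 0 (P - Q) * (indicator (S T) Q * f (u (fst Q) (snd Q)))" for Q
    using tx by (cases Q) (auto simp: causal_kernel_def S_def indicator_def)
  have sol: "set_integrable lborel ({0..t} \<times> UNIV) (\<lambda>(s, y). heat_kernel (t - s) (x - y) * f (u s y))"
    "u t x = (LINT p:{0..t} \<times> UNIV|lborel. (\<lambda>(s, y). heat_kernel (t - s) (x - y) * f (u s y)) p) + z t x"
    using assms(2) tx(2) unfolding is_solution_def by blast+
  show "integrable lborel (\<lambda>Q. causal_kernel 0 (P - Q) * (indicator (S T) Q * f (u (fst Q) (snd Q))))"
    using sol(1) unfolding set_integrable_def eq .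
  show "u (fst P) (snd P)
      = (\<integral>Q. causal_kernel 0 (P - Q) * (indicator (S T) Q * f (u (fst Q) (snd Q))) \<partial>lborel) + z (fst P) (snd P)"
    using sol(2) unfolding set_lebesgue_integral_def eq by (simp add: tx)
qed

lemma solution_difference_le:
  fixes u1 u2 z1 z2 :: "real \<Rightarrow> 'a::euclidean_space \<Rightarrow> real"
  assumes \<theta>: "0 < \<theta>" and \<kappa>: "0 < \<kappa>" and M: "0 \<le> M"
    and f: "continuous_on UNIV f" "\<And>a b. a < b \<Longrightarrow> f b - f a \<le> \<kappa> * (b - a)"
    and z: "z1 \<in> Cb T" "z2 \<in> Cb T"
    and u: "is_solution f T z1 u1" "is_solution f T z2 u2"
    and \<zeta>: "\<And>t x. t \<in> {0..T} \<Longrightarrow> \<bar>z1 t x - z2 t x\<bar> \<le> M * poly_weight \<theta> x0 x"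
    and t: "t \<in> {0..T}"
  shows "u1 t x - u2 t x - (z1 t x - z2 t x) \<le> 2 * M * exp (2 * \<kappa> * t) * heat_flow \<theta> x0 (t, x)"
proof -
  let ?S = "{0..T} \<times> (UNIV :: 'a set)"
  have cont: "continuous_on ?S (\<lambda>Q. w (fst Q) (snd Q))" if "w \<in> {u1, u2, z1, z2}" for w
    using that u z unfolding is_solution_def Cb_def by (auto simp: case_prod_unfold)
  have "(\<lambda>Q. u1 (fst Q) (snd Q) - u2 (fst Q) (snd Q) - (z1 (fst Q) (snd Q) - z2 (fst Q) (snd Q))) (t, x)
      \<le> 2 * M * exp (2 * \<kappa> * fst (t, x)) * heat_flow \<theta> x0 (t, x)"
  proof (rule mild_comparison[where g = "\<lambda>Q. f (u1 (fst Q) (snd Q)) - f (u2 (fst Q) (snd Q))"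
        and \<zeta> = "\<lambda>Q. z1 (fst Q) (snd Q) - z2 (fst Q) (snd Q)", OF \<theta> \<kappa> M])
    show "continuous_on ?S (\<lambda>Q. u1 (fst Q) (snd Q) - u2 (fst Q) (snd Q) - (z1 (fst Q) (snd Q) - z2 (fst Q) (snd Q)))"
      by (intro continuous_intros cont) auto
    show "continuous_on ?S (\<lambda>Q. f (u1 (fst Q) (snd Q)) - f (u2 (fst Q) (snd Q)))"
      by (intro continuous_intros continuous_on_compose2[OF f(1)] cont) auto
    show "(t, x) \<in> ?S"
      using t by auto
    fix P :: "real \<times> 'a"
    assume P: "P \<in> ?S"
    have split: "causal_kernel 0 (P - Q) * (indicator ?S Q * (f (u1 (fst Q) (snd Q)) - f (u2 (fst Q) (snd Q))))
      = causal_kernel 0 (P - Q) * (indicator ?S Q * f (u1 (fst Q) (snd Q)))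
        - causal_kernel 0 (P - Q) * (indicator ?S Q * f (u2 (fst Q) (snd Q)))" for Q
      by (simp add: algebra_simps)
    note s1 = is_solution_causal_kernel[OF u(1) P] and s2 = is_solution_causal_kernel[OF u(2) P]
    show "integrable lborel (\<lambda>Q. causal_kernel 0 (P - Q) * (indicator ?S Q * (f (u1 (fst Q) (snd Q)) - f (u2 (fst Q) (snd Q)))))"
      unfolding split by (intro Bochner_Integration.integrable_diff s1 s2)
    show "u1 (fst P) (snd P) - u2 (fst P) (snd P) - (z1 (fst P) (snd P) - z2 (fst P) (snd P))
      = (\<integral>Q. causal_kernel 0 (P - Q) * (indicator ?S Q * (f (u1 (fst Q) (snd Q)) - f (u2 (fst Q) (snd Q)))) \<partial>lborel)"
      unfolding split Bochner_Integration.integral_diff[OF s1(1) s2(1)] using s1(2) s2(2) by linarith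
    show "\<bar>z1 (fst P) (snd P) - z2 (fst P) (snd P)\<bar> \<le> M * poly_weight \<theta> x0 (snd P)"
      using P by (intro \<zeta>) auto
    assume "0 \<le> u1 (fst P) (snd P) - u2 (fst P) (snd P) - (z1 (fst P) (snd P) - z2 (fst P) (snd P))
        + (z1 (fst P) (snd P) - z2 (fst P) (snd P))"
    then have "u2 (fst P) (snd P) \<le> u1 (fst P) (snd P)"
      by linarith
    then show "f (u1 (fst P) (snd P)) - f (u2 (fst P) (snd P))
      \<le> \<kappa> * (u1 (fst P) (snd P) - u2 (fst P) (snd P) - (z1 (fst P) (snd P) - z2 (fst P) (snd P))
        + (z1 (fst P) (snd P) - z2 (fst P) (snd P)))"
      \<comment> \<open>The hypothesis on \<open>f\<close> covers only strict inequality; for equal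
        values both sides are zero.\<close>
      using f(2)[of "u2 (fst P) (snd P)" "u1 (fst P) (snd P)"]
      by (cases "u2 (fst P) (snd P) = u1 (fst P) (snd P)") auto
  qed
  then show ?thesis
    by simp
qed

section \<open>Weighted suprema, stability and uniqueness\<close>

text \<open>Boundedness of \<open>w\<close> ensures that the real-valued \<open>SUP\<close> really
  is an upper bound.\<close>

lemma wsup_upper:
  assumes "w \<in> Cb T" "t \<in> {0..T}"
  shows "\<bar>w t x\<bar> \<le> wsup \<theta> T x0 w * poly_weight \<theta> x0 x"
proof -
  obtain B where B: "\<And>t x. t \<in> {0..T} \<Longrightarrow> \<bar>w t x\<bar> \<le> B"
    using assms(1) unfolding Cb_def by blast
  have "bdd_above ((\<lambda>p. \<bar>w (fst p) (snd p)\<bar> / (1 + norm (snd p - x0) powr \<theta>)) ` ({0..T} \<times> UNIV))"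
  proof (rule bdd_aboveI2)
    fix p :: "real \<times> 'a"
    assume "p \<in> {0..T} \<times> UNIV"
    then have "\<bar>w (fst p) (snd p)\<bar> \<le> B"
      by (intro B) auto
    moreover have "\<bar>w (fst p) (snd p)\<bar> / (1 + norm (snd p - x0) powr \<theta>) \<le> \<bar>w (fst p) (snd p)\<bar> / 1"
      by (intro divide_left_mono) (auto intro: add_pos_nonneg)
    ultimately show "\<bar>w (fst p) (snd p)\<bar> / (1 + norm (snd p - x0) powr \<theta>) \<le> B"
      by simp
  qed
  then have "\<bar>w (fst (t, x)) (snd (t, x))\<bar> / (1 + norm (snd (t, x) - x0) powr \<theta>) \<le> wsup \<theta> T x0 w"
    unfolding wsup_def using assms(2) by (intro cSUP_upper) auto
  moreover have "0 < poly_weight \<theta> x0 x"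
    using poly_weight_ge_1[of \<theta> x0 x] by linarith
  ultimately show ?thesis
    by (simp add: pos_divide_le_eq poly_weight_def)
qed

lemma Cb_diff:
  assumes "z1 \<in> Cb T" "z2 \<in> Cb T"
  shows "(\<lambda>t x. z1 t x - z2 t x) \<in> Cb T"
proof -
  obtain B1 B2 where "\<forall>t\<in>{0..T}. \<forall>x. \<bar>z1 t x\<bar> \<le> B1" "\<forall>t\<in>{0..T}. \<forall>x. \<bar>z2 t x\<bar> \<le> B2"
    using assms unfolding Cb_def by blast
  then have "\<forall>t\<in>{0..T}. \<forall>x. \<bar>z1 t x - z2 t x\<bar> \<le> B1 + B2"
    by (meson abs_triangle_ineq4 add_mono order_trans)
  then show ?thesis
    using assms unfolding Cb_def by (auto simp: case_prod_unfold intro!: continuous_intros)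
qed

text \<open>The bound is pointwise: solutions are not known to be bounded beforehand, so a real
  supremum over them would carry no information by itself.\<close>

lemma mild_solution_stability:
  fixes \<kappa> \<theta> :: real
  assumes \<theta>: "0 < \<theta>"
  obtains C where "0 < C"
    "\<And>f T z1 z2 u1 u2 (x0::'a::euclidean_space) t x. continuous_on UNIV f \<Longrightarrow> (\<And>a b. a < b \<Longrightarrow> f b - f a \<le> \<kappa> * (b - a)) \<Longrightarrow>
       z1 \<in> Cb T \<Longrightarrow> z2 \<in> Cb T \<Longrightarrow> is_solution f T z1 u1 \<Longrightarrow> is_solution f T z2 u2 \<Longrightarrow> t \<in> {0..T} \<Longrightarrow>
       \<bar>u1 t x - u2 t x\<bar> / (1 + norm (x - x0) powr \<theta>) \<le> C * exp (C * T) * wsup \<theta> T x0 (\<lambda>t x. z1 t x - z2 t x)"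
proof -
  obtain K where K: "0 \<le> K"
    "\<And>x0 t (x::'a). 0 \<le> t \<Longrightarrow> heat_flow \<theta> x0 (t, x) \<le> K * (1 + sqrt t powr \<theta>) * poly_weight \<theta> x0 x"
    using heat_flow_le[OF \<theta>] by blast
  \<comment> \<open>The comparison needs a positive constant, and enlarging \<open>\<kappa>\<close>
    preserves the one-sided bound.\<close>
  define k where "k = max \<kappa> 1"
  \<comment> \<open>The 8 is the product of the 2 in \<open>2 * \<Phi>\<close>, the 2 in
    \<open>\<Phi>\<close> and the 2 in \<open>1 + sqrt t powr \<theta> \<le> 2 * exp
    (\<theta>\<^sup>2) * exp T\<close>; \<open>2 * k + 1\<close> covers the exponents
    \<open>2 * k * t\<close> and \<open>T\<close>.\<close>
  define C where "C = 8 * K * exp (\<theta>\<^sup>2) + 2 * k + 1"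
  have k: "0 < k" "\<kappa> \<le> k"
    by (auto simp: k_def)
  have C: "0 < C" "8 * K * exp (\<theta>\<^sup>2) \<le> C" "2 * k + 1 \<le> C"
    using K(1) k by (auto simp: C_def intro: add_nonneg_pos)
  show thesis
  proof (rule that[OF C(1)])
    fix f T and z1 z2 u1 u2 :: "real \<Rightarrow> 'a \<Rightarrow> real" and x0 :: 'a and t x
    assume f: "continuous_on UNIV f" "\<And>a b. a < b \<Longrightarrow> f b - f a \<le> \<kappa> * (b - a)"
      and z: "z1 \<in> Cb T" "z2 \<in> Cb T"
      and u: "is_solution f T z1 u1" "is_solution f T z2 u2"
      and t: "t \<in> {0..T}"
    have fk: "f b - f a \<le> k * (b - a)" if "a < b" for a b
      using f(2)[OF that] mult_right_mono[OF k(2), of "b - a"] that by linarith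
    define M where "M = wsup \<theta> T x0 (\<lambda>t x. z1 t x - z2 t x)"
    have \<zeta>: "\<bar>z1 t x - z2 t x\<bar> \<le> M * poly_weight \<theta> x0 x" if "t \<in> {0..T}" for t x
      unfolding M_def using wsup_upper[OF Cb_diff[OF z] that] .
    have pos: "0 < poly_weight \<theta> x0 x" for x
      using poly_weight_ge_1[of \<theta> x0 x] by linarith
    have M: "0 \<le> M"
    proof -
      have "0 \<le> M * poly_weight \<theta> x0 x"
        using \<zeta>[OF t, of x] by linarith
      then show ?thesis
        using pos[of x] by (simp add: zero_le_mult_iff)
    qed
    define \<Phi> where "\<Phi> = 2 * M * exp (2 * k * t) * heat_flow \<theta> x0 (t, x)"
    have "u1 t x - u2 t x - (z1 t x - z2 t x) \<le> \<Phi>"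
      unfolding \<Phi>_def by (rule solution_difference_le[OF \<theta> k(1) M f(1) fk z u \<zeta> t])
    moreover have "u2 t x - u1 t x - (z2 t x - z1 t x) \<le> \<Phi>"
      unfolding \<Phi>_def
      by (rule solution_difference_le[OF \<theta> k(1) M f(1) fk z(2,1) u(2,1) _ t]) (use \<zeta> in \<open>simp_all add: abs_minus_commute\<close>)
    \<comment> \<open>The comparison controls the difference of the solutions only up to that of the
      data, which lies below the same barrier; hence \<open>2 * \<Phi>\<close>.\<close>
    moreover have "\<bar>z1 t x - z2 t x\<bar> \<le> \<Phi>"
      using \<zeta>[OF t, of x] poly_weight_le_exp_heat_flow[OF \<theta> M, of "2 * k" "(t, x)" x0] k t
      by (simp add: \<Phi>_def)
    ultimately have "\<bar>u1 t x - u2 t x\<bar> \<le> 2 * \<Phi>"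
      by linarith
    also have "2 * \<Phi> \<le> 4 * M * exp (2 * k * t) * (K * (2 * exp (\<theta>\<^sup>2) * exp T) * poly_weight \<theta> x0 x)"
    proof -
      \<comment> \<open>Polynomial growth in time is absorbed into \<open>exp T\<close>.\<close>
      have "sqrt t powr \<theta> \<le> exp (\<theta>\<^sup>2) * exp ((sqrt t)\<^sup>2 / 4)"
        using \<theta> t by (intro powr_le_exp_square) auto
      also have "\<dots> \<le> exp (\<theta>\<^sup>2) * exp T"
        using t by (intro mult_left_mono) auto
      finally have "sqrt t powr \<theta> \<le> exp (\<theta>\<^sup>2) * exp T" .
      moreover have "1 \<le> exp (\<theta>\<^sup>2) * exp T"
        using t by (simp flip: exp_add)
      ultimately have "1 + sqrt t powr \<theta> \<le> 2 * exp (\<theta>\<^sup>2) * exp T"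
        by linarith
      then have "K * (1 + sqrt t powr \<theta>) * poly_weight \<theta> x0 x \<le> K * (2 * exp (\<theta>\<^sup>2) * exp T) * poly_weight \<theta> x0 x"
        using K(1) by (intro mult_right_mono mult_left_mono) auto
      with K(2)[of t x0 x] t have "heat_flow \<theta> x0 (t, x) \<le> K * (2 * exp (\<theta>\<^sup>2) * exp T) * poly_weight \<theta> x0 x"
        by simp
      then have "4 * M * exp (2 * k * t) * heat_flow \<theta> x0 (t, x)
        \<le> 4 * M * exp (2 * k * t) * (K * (2 * exp (\<theta>\<^sup>2) * exp T) * poly_weight \<theta> x0 x)"
        using M by (intro mult_left_mono) auto
      then show ?thesis
        by (simp add: \<Phi>_def)
    qed
    also have "\<dots> = (8 * K * exp (\<theta>\<^sup>2)) * exp (2 * k * t + T) * (M * poly_weight \<theta> x0 x)"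
      by (simp add: exp_add)
    also have "\<dots> \<le> C * exp (C * T) * (M * poly_weight \<theta> x0 x)"
    proof -
      have "2 * k * t + T \<le> 2 * k * T + T"
        using k t by simp
      also have "\<dots> \<le> C * T"
        using mult_right_mono[OF C(3), of T] t by (simp add: algebra_simps)
      finally have "exp (2 * k * t + T) \<le> exp (C * T)"
        by simp
      then show ?thesis
        using C K(1) M by (intro mult_right_mono mult_mono) auto
    qed
    finally show "\<bar>u1 t x - u2 t x\<bar> / (1 + norm (x - x0) powr \<theta>) \<le> C * exp (C * T) * wsup \<theta> T x0 (\<lambda>t x. z1 t x - z2 t x)"
      using pos[of x] unfolding M_def[symmetric] poly_weight_def[symmetric] by (simp add: pos_divide_le_eq mult.assoc)
  qed
qed

theorem mainTheorem11:
  fixes \<kappa> \<theta> :: real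
  assumes "\<theta> > 0"
  shows "\<exists>C>0. \<forall>(f::real \<Rightarrow> real). continuous_on UNIV f \<longrightarrow>
           (\<forall>u1 u2. u1 < u2 \<longrightarrow> f u2 - f u1 \<le> \<kappa> * (u2 - u1)) \<longrightarrow>
           (\<forall>T>0. \<forall>z1 z2 u1 u2 (x0::'a::euclidean_space).
              z1 \<in> Cb T \<longrightarrow> z2 \<in> Cb T \<longrightarrow> is_solution f T z1 u1 \<longrightarrow> is_solution f T z2 u2 \<longrightarrow>
              (\<forall>t\<in>{0..T}. \<forall>x. \<bar>u1 t x - u2 t x\<bar> / (1 + norm (x - x0) powr \<theta>)
                   \<le> C * exp (C * T) * wsup \<theta> T x0 (\<lambda>t x. z1 t x - z2 t x)))
           \<and> (\<forall>T>0. \<forall>z (u::real \<Rightarrow> 'a \<Rightarrow> real) v. z \<in> Cb T \<longrightarrow> is_solution f T z u \<longrightarrow>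
                is_solution f T z v \<longrightarrow> (\<forall>t\<in>{0..T}. \<forall>x. u t x = v t x))"
proof -
  obtain C where C: "0 < C"
    "\<And>f T z1 z2 u1 u2 (x0::'a) t x. continuous_on UNIV f \<Longrightarrow> (\<And>a b. a < b \<Longrightarrow> f b - f a \<le> \<kappa> * (b - a)) \<Longrightarrow>
       z1 \<in> Cb T \<Longrightarrow> z2 \<in> Cb T \<Longrightarrow> is_solution f T z1 u1 \<Longrightarrow> is_solution f T z2 u2 \<Longrightarrow> t \<in> {0..T} \<Longrightarrow>
       \<bar>u1 t x - u2 t x\<bar> / (1 + norm (x - x0) powr \<theta>) \<le> C * exp (C * T) * wsup \<theta> T x0 (\<lambda>t x. z1 t x - z2 t x)"
    using mild_solution_stability[OF assms, of \<kappa>] by blast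
  have "u t x = v t x"
    if "continuous_on UNIV f" "\<forall>a b. a < b \<longrightarrow> f b - f a \<le> \<kappa> * (b - a)"
      and "z \<in> Cb T" "is_solution f T z u" "is_solution f T z v" "t \<in> {0..T}"
    for f T and z u v :: "real \<Rightarrow> 'a \<Rightarrow> real" and t x
  proof -
    \<comment> \<open>Nonemptiness is needed for the supremum of the constant 0 to be 0; stability
      with equal data and centre 0 then gives uniqueness.\<close>
    have "{0..T} \<times> (UNIV :: 'a set) \<noteq> {}"
      using that(6) by auto
    then have "wsup \<theta> T (0 :: 'a) (\<lambda>t x. z t x - z t x) = 0"
      by (simp add: wsup_def)
    moreover have "\<bar>u t x - v t x\<bar> / (1 + norm (x - 0) powr \<theta>) \<le> C * exp (C * T) * wsup \<theta> T 0 (\<lambda>t x. z t x - z t x)"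
      using that by (intro C(2)[of f]) auto
    ultimately have "\<bar>u t x - v t x\<bar> / (1 + norm x powr \<theta>) \<le> 0"
      by simp
    moreover have "0 < 1 + norm x powr \<theta>"
      by (simp add: add_pos_nonneg)
    ultimately show ?thesis
      by (simp add: divide_le_0_iff)
  qed
  with C show ?thesis
    by (intro exI[of _ C] conjI allI impI ballI) (auto intro: C(2))
qed

end
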